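(* Let $\gamma\in(1,\tfrac53]$, $\phi(p_{\min})<0$ and $\phi(p_{\max})\ne 0$. For every $\epsilon>0$, there exists $k(u_L,a_L,u_R,a_R,\gamma,\epsilon)$ such that Algorithm 2, run in exact arithmetic with tolerance $\epsilon$ and with input the pair $(p_1^0,p_2^0)$ produced by Algorithm 1, terminates when $k=k(u_L,a_L,u_R,a_R,\gamma,\epsilon)$, and in this case $$|\lambda_{\max}^k-\lambda_{\max}|\le \epsilon\,\lambda_{\max},$$ i.e. the relative error on $\lambda_{\max}$ is guaranteed to be bounded by $\epsilon$.
   Context: Data. Fix $\gamma>1$ and $b\ge 0$. A left state $(\rho_L,u_L,p_L)$ and a right state $(\rho_R,u_R,p_R)$ (density, velocity, pressure) are given with $\rho_L,\rho_R>0$, $1-b\rho_L>0$, $1-b\rho_R>0$, $p_L,p_R>0$ and $u_L,u_R\in\mathbb{R}$. Set $p_{\min}:=\min(p_L,p_R)$, $p_{\max}:=\max(p_L,p_R)$, $z_+:=\max(0,z)$, $z_-:=\max(0,-z)$. For $Z\in\{L,R\}$ let $a_Z:=\sqrt{\frac{\gamma p_Z}{\rho_Z(1-b\rho_Z)}}$ (the local sound speed), $A_Z:=\frac{2(1-b\rho_Z)}{(\gamma+1)\rho_Z}$, $B_Z:=\frac{\gamma-1}{\gamma+1}p_Z$, and for $p\ge0$ $$f(p,Z):=\begin{cases}(p-p_Z)\left(\frac{A_Z}{p+B_Z}\right)^{1/2}&\text{if }p\ge p_Z,\\ \frac{2a_Z(1-b\rho_Z)}{\gamma-1}\left(\left(\frac{p}{p_Z}\right)^{\frac{\gamma-1}{2\gamma}}-1\right)&\text{if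 }p<p_Z,\end{cases}\qquad \phi(p):=f(p,L)+f(p,R)+u_R-u_L.$$ The function $\phi$ is $C^2$ on $(0,\infty)$, strictly increasing and concave, and tends to $+\infty$. When $\phi(p_{\min})<0$, let $p^*$ be its unique positive zero, and let $\tilde p^*$ be the unique zero of $$\phi_R(p):=\sum_{Z\in\{L,R\}}\frac{2a_Z(1-b\rho_Z)}{\gamma-1}\left(\left(\frac{p}{p_Z}\right)^{\frac{\gamma-1}{2\gamma}}-1\right)+u_R-u_L .$$ Wave speeds. $\lambda_1^-:=u_L-a_L\left(1+\frac{\gamma+1}{2\gamma}\left(\frac{p^*-p_L}{p_L}\right)_+\right)^{1/2}$, $\lambda_3^+:=u_R+a_R\left(1+\frac{\gamma+1}{2\gamma}\left(\frac{p^*-p_R}{p_R}\right)_+\right)^{1/2}$ (the extreme wave speeds of the Riemann problem for the one-dimensional Euler equations with the co-volume equation of state), and $\lambda_{\max}:=\max((\lambda_1^-)_-,(\lambda_3^+)_+)$. Given $p_1^k,p_2^k$ set $$v_{11}^k=u_L-a_L\left(1+\tfrac{\gamma+1}{2\gamma}\big(\tfrac{p_2^k-p_L}{p_L}\big)_+\right)^{1/2},\quad v_{12}^k=u_L-a_L\left(1+\tfrac{\gamma+1}{2\gamma}\big(\tfrac{p_1^k-p_L}{p_L}\big)_+\right)^{1/2},$$ $$v_{31}^k=u_R+a_R\left(1+\tfrac{\gamma+1}{2\gamma}\big(\tfrac{p_1^k-p_R}{p_R}\big)_+\right)^{1/2},\quad v_{32}^k=u_R+a_R\left(1+\tfrac{\gamma+1}{2\gamma}\big(\tfrac{p_2^k-p_R}{p_R}\big)_+\right)^{1/2},$$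 $\lambda_{\min}^k:=(\max((v_{31}^k)_+,(v_{12}^k)_-))_+$ and $\lambda_{\max}^k:=\max((v_{32}^k)_+,(v_{11}^k)_-)$. Algorithm 1 (initialization; case $\phi(p_{\min})<0$, $\phi(p_{\max})\ne0$). If $\phi(p_{\max})<0$ set $p_1^0=p_{\max}$, $p_2^0=\tilde p^*$; otherwise set $p_1^0=p_{\min}$, $p_2^0=\min(p_{\max},\tilde p^* )$. Compute $\lambda_{\max}^0,\lambda_{\min}^0$; if $\lambda_{\min}^0>0$ and $\lambda_{\max}^0/\lambda_{\min}^0-1\le\epsilon$, return (stop already). Otherwise replace $p_1^0$ by $\max\big(p_1^0,\;p_2^0-\phi(p_2^0)/\phi'(p_2^0)\big)$ and pass $(p_1^0,p_2^0)$ to Algorithm 2. Algorithm 2. For $k=0,1,2,\dots$: compute $\lambda_{\max}^k,\lambda_{\min}^k$ from $(p_1^k,p_2^k)$; if $\lambda_{\min}^k>0$ and $\lambda_{\max}^k/\lambda_{\min}^k-1\le\epsilon$, terminate and output $\lambda_{\max}^k$; if $\phi(p_1^k)>0$ or $\phi(p_2^k)<0$ (a safeguard against roundoff), terminate and output $\lambda_{\max}^k$; otherwise set $p_1^{k+1}=p_d(p_1^k,p_2^k)$, $p_2^{k+1}=p_u(p_1^k,p_2^k)$, where $$p_d(p_1,p_2)=p_1-\frac{2\phi(p_1)}{\phi'(p_1)+\sqrt{\phi'(p_1)^2-4\phi(p_1)\phi[p_1,p_1,p_2]}},\quad p_u(p_1,p_2)=p_2-\frac{2\phi(p_2)}{\phi'(p_2)+\sqrt{\phi'(p_2)^2-4\phi(p_2)\phi[p_1,p_2,p_2]}},$$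 with divided differences $\phi[p_1,p_2]=\frac{\phi(p_2)-\phi(p_1)}{p_2-p_1}$, $\phi[p_1,p_1,p_2]=\frac{\phi[p_1,p_2]-\phi'(p_1)}{p_2-p_1}$, $\phi[p_1,p_2,p_2]=\frac{\phi'(p_2)-\phi[p_1,p_2]}{p_2-p_1}$.
   Formalization: The index k may depend on all the data (also on the pressures, densities and b), not only on u_L, a_L, u_R, a_R, γ, ε; with only the listed quantities the claim fails, since the terminating index changes with p_L/p_R. *)

theory Defs
  imports "HOL-Analysis.Analysis"
begin

record state =
  rho :: real  \<comment> \<open>density\<close>
  vel :: real  \<comment> \<open>velocity\<close>
  pres :: real \<comment> \<open>pressure\<close>

definition admissible :: "real \<Rightarrow> state \<Rightarrow> bool" where
  "admissible b Z \<longleftrightarrow> rho Z > 0 \<and> 1 - b * rho Z > 0 \<and> pres Z > 0"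

definition p_min :: "state \<Rightarrow> state \<Rightarrow> real" where
  "p_min L R = min (pres L) (pres R)"

definition p_max :: "state \<Rightarrow> state \<Rightarrow> real" where
  "p_max L R = max (pres L) (pres R)"

definition pos_part :: "real \<Rightarrow> real" where
  "pos_part z = max 0 z"

definition neg_part :: "real \<Rightarrow> real" where
  "neg_part z = max 0 (- z)"

definition sound_speed :: "real \<Rightarrow> real \<Rightarrow> state \<Rightarrow> real" where
  "sound_speed \<gamma> b Z = sqrt (\<gamma> * pres Z / (rho Z * (1 - b * rho Z)))"

definition coeff_A :: "real \<Rightarrow> real \<Rightarrow> state \<Rightarrow> real" where
  "coeff_A \<gamma> b Z = 2 * (1 - b * rho Z) / ((\<gamma> + 1) * rho Z)"

definition coeff_B :: "real \<Rightarrow> state \<Rightarrow> real" where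
  "coeff_B \<gamma> Z = (\<gamma> - 1) / (\<gamma> + 1) * pres Z"

definition shock_curve :: "real \<Rightarrow> real \<Rightarrow> state \<Rightarrow> real \<Rightarrow> real" where
  "shock_curve \<gamma> b Z p = (p - pres Z) * sqrt (coeff_A \<gamma> b Z / (p + coeff_B \<gamma> Z))"

definition rarefaction_curve :: "real \<Rightarrow> real \<Rightarrow> state \<Rightarrow> real \<Rightarrow> real" where
  "rarefaction_curve \<gamma> b Z p =
     2 * sound_speed \<gamma> b Z * (1 - b * rho Z) / (\<gamma> - 1)
       * ((p / pres Z) powr ((\<gamma> - 1) / (2 * \<gamma>)) - 1)"

text \<open>The functions \<open>wave_f\<close>, \<open>phi\<close> and \<open>phi_R\<close> are meaningful for pressures \<open>p \<ge> 0\<close> only;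
  their values at negative arguments are never used.\<close>

definition wave_f :: "real \<Rightarrow> real \<Rightarrow> state \<Rightarrow> real \<Rightarrow> real" where
  "wave_f \<gamma> b Z p =
     (if p \<ge> pres Z then shock_curve \<gamma> b Z p else rarefaction_curve \<gamma> b Z p)"

definition phi :: "real \<Rightarrow> real \<Rightarrow> state \<Rightarrow> state \<Rightarrow> real \<Rightarrow> real" where
  "phi \<gamma> b L R p = wave_f \<gamma> b L p + wave_f \<gamma> b R p + vel R - vel L"

definition phi_R :: "real \<Rightarrow> real \<Rightarrow> state \<Rightarrow> state \<Rightarrow> real \<Rightarrow> real" where
  "phi_R \<gamma> b L R p =
     rarefaction_curve \<gamma> b L p + rarefaction_curve \<gamma> b R p + vel R - vel L"

text \<open>Both zeros below exist and are unique when \<open>phi \<gamma> b L R (p_min L R) < 0\<close>.\<close>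

definition p_star :: "real \<Rightarrow> real \<Rightarrow> state \<Rightarrow> state \<Rightarrow> real" where
  "p_star \<gamma> b L R = (THE p. p > 0 \<and> phi \<gamma> b L R p = 0)"

definition p_tilde_star :: "real \<Rightarrow> real \<Rightarrow> state \<Rightarrow> state \<Rightarrow> real" where
  "p_tilde_star \<gamma> b L R = (THE p. p \<ge> 0 \<and> phi_R \<gamma> b L R p = 0)"

text \<open>The extreme wave speeds as functions of the intermediate pressure \<open>p\<close>: the exact speeds
  \<open>\<lambda>\<^sub>1\<^sup>-\<close>, \<open>\<lambda>\<^sub>3\<^sup>+\<close> are obtained at \<open>p = p_star\<close>, while \<open>v\<^sub>1\<^sub>1, v\<^sub>3\<^sub>2\<close> are obtained at the upper
  iterate \<open>p\<^sub>2\<close> and \<open>v\<^sub>1\<^sub>2, v\<^sub>3\<^sub>1\<close> at the lower iterate \<open>p\<^sub>1\<close>.\<close>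

definition speed_factor :: "real \<Rightarrow> state \<Rightarrow> real \<Rightarrow> real" where
  "speed_factor \<gamma> Z p = sqrt (1 + (\<gamma> + 1) / (2 * \<gamma>) * pos_part ((p - pres Z) / pres Z))"

definition speed_1 :: "real \<Rightarrow> real \<Rightarrow> state \<Rightarrow> real \<Rightarrow> real" where
  "speed_1 \<gamma> b L p = vel L - sound_speed \<gamma> b L * speed_factor \<gamma> L p"

definition speed_3 :: "real \<Rightarrow> real \<Rightarrow> state \<Rightarrow> real \<Rightarrow> real" where
  "speed_3 \<gamma> b R p = vel R + sound_speed \<gamma> b R * speed_factor \<gamma> R p"

definition lambda_max :: "real \<Rightarrow> real \<Rightarrow> state \<Rightarrow> state \<Rightarrow> real" where
  "lambda_max \<gamma> b L R =
     max (neg_part (speed_1 \<gamma> b L (p_star \<gamma> b L R))) (pos_part (speed_3 \<gamma> b R (p_star \<gamma> b L R)))"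

definition lambda_lower :: "real \<Rightarrow> real \<Rightarrow> state \<Rightarrow> state \<Rightarrow> real \<times> real \<Rightarrow> real" where
  "lambda_lower \<gamma> b L R = (\<lambda>(p1, p2).
     pos_part (max (pos_part (speed_3 \<gamma> b R p1)) (neg_part (speed_1 \<gamma> b L p1))))"

definition lambda_upper :: "real \<Rightarrow> real \<Rightarrow> state \<Rightarrow> state \<Rightarrow> real \<times> real \<Rightarrow> real" where
  "lambda_upper \<gamma> b L R = (\<lambda>(p1, p2).
     max (pos_part (speed_3 \<gamma> b R p2)) (neg_part (speed_1 \<gamma> b L p2)))"

definition tolerance_met ::
    "real \<Rightarrow> real \<Rightarrow> state \<Rightarrow> state \<Rightarrow> real \<Rightarrow> real \<times> real \<Rightarrow> bool" where
  "tolerance_met \<gamma> b L R \<epsilon> q \<longleftrightarrow>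
     lambda_lower \<gamma> b L R q > 0 \<and> lambda_upper \<gamma> b L R q / lambda_lower \<gamma> b L R q - 1 \<le> \<epsilon>"

text \<open>Algorithm 1 either stops at once and returns a wave speed, or passes a pair of pressures
  on to Algorithm 2.\<close>

datatype alg1_result = Stop real | Pass "real \<times> real"

definition initial_guess :: "real \<Rightarrow> real \<Rightarrow> state \<Rightarrow> state \<Rightarrow> real \<times> real" where
  "initial_guess \<gamma> b L R =
     (if phi \<gamma> b L R (p_max L R) < 0 then (p_max L R, p_tilde_star \<gamma> b L R)
      else (p_min L R, min (p_max L R) (p_tilde_star \<gamma> b L R)))"

definition newton_update :: "real \<Rightarrow> real \<Rightarrow> state \<Rightarrow> state \<Rightarrow> real \<times> real \<Rightarrow> real \<times> real" where
  "newton_update \<gamma> b L R = (\<lambda>(p1, p2).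
     (max p1 (p2 - phi \<gamma> b L R p2 / deriv (phi \<gamma> b L R) p2), p2))"

definition algorithm1 :: "real \<Rightarrow> real \<Rightarrow> state \<Rightarrow> state \<Rightarrow> real \<Rightarrow> alg1_result" where
  "algorithm1 \<gamma> b L R \<epsilon> =
     (let q = initial_guess \<gamma> b L R in
      if tolerance_met \<gamma> b L R \<epsilon> q then Stop (lambda_upper \<gamma> b L R q)
      else Pass (newton_update \<gamma> b L R q))"

definition divdiff :: "(real \<Rightarrow> real) \<Rightarrow> real \<Rightarrow> real \<Rightarrow> real" where
  "divdiff g p1 p2 = (g p2 - g p1) / (p2 - p1)"

definition divdiff_112 :: "(real \<Rightarrow> real) \<Rightarrow> real \<Rightarrow> real \<Rightarrow> real" where
  "divdiff_112 g p1 p2 = (divdiff g p1 p2 - deriv g p1) / (p2 - p1)"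

definition divdiff_122 :: "(real \<Rightarrow> real) \<Rightarrow> real \<Rightarrow> real \<Rightarrow> real" where
  "divdiff_122 g p1 p2 = (deriv g p2 - divdiff g p1 p2) / (p2 - p1)"

definition p_d :: "(real \<Rightarrow> real) \<Rightarrow> real \<Rightarrow> real \<Rightarrow> real" where
  "p_d g p1 p2 =
     p1 - 2 * g p1 / (deriv g p1 + sqrt ((deriv g p1)\<^sup>2 - 4 * g p1 * divdiff_112 g p1 p2))"

definition p_u :: "(real \<Rightarrow> real) \<Rightarrow> real \<Rightarrow> real \<Rightarrow> real" where
  "p_u g p1 p2 =
     p2 - 2 * g p2 / (deriv g p2 + sqrt ((deriv g p2)\<^sup>2 - 4 * g p2 * divdiff_122 g p1 p2))"

text \<open>The sequence of pairs \<open>(p\<^sub>1\<^sup>k, p\<^sub>2\<^sup>k)\<close> is defined for all \<open>k\<close>; Algorithm 2 computes its members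
  up to the first one at which a stopping test succeeds.\<close>

primrec alg2_iterate ::
    "real \<Rightarrow> real \<Rightarrow> state \<Rightarrow> state \<Rightarrow> real \<times> real \<Rightarrow> nat \<Rightarrow> real \<times> real" where
  "alg2_iterate \<gamma> b L R q 0 = q"
| "alg2_iterate \<gamma> b L R q (Suc k) =
     (case alg2_iterate \<gamma> b L R q k of (p1, p2) \<Rightarrow>
        (p_d (phi \<gamma> b L R) p1 p2, p_u (phi \<gamma> b L R) p1 p2))"

definition safeguard :: "real \<Rightarrow> real \<Rightarrow> state \<Rightarrow> state \<Rightarrow> real \<times> real \<Rightarrow> bool" where
  "safeguard \<gamma> b L R = (\<lambda>(p1, p2). phi \<gamma> b L R p1 > 0 \<or> phi \<gamma> b L R p2 < 0)"

definition alg2_stops :: "real \<Rightarrow> real \<Rightarrow> state \<Rightarrow> state \<Rightarrow> real \<Rightarrow> real \<times> real \<Rightarrow> bool" where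
  "alg2_stops \<gamma> b L R \<epsilon> q \<longleftrightarrow> tolerance_met \<gamma> b L R \<epsilon> q \<or> safeguard \<gamma> b L R q"

definition alg2_terminates_at ::
    "real \<Rightarrow> real \<Rightarrow> state \<Rightarrow> state \<Rightarrow> real \<Rightarrow> real \<times> real \<Rightarrow> nat \<Rightarrow> bool" where
  "alg2_terminates_at \<gamma> b L R \<epsilon> q k \<longleftrightarrow>
     alg2_stops \<gamma> b L R \<epsilon> (alg2_iterate \<gamma> b L R q k) \<and>
     (\<forall>j<k. \<not> alg2_stops \<gamma> b L R \<epsilon> (alg2_iterate \<gamma> b L R q j))"

end

theory Submission
  imports Defs
begin

text \<open>
  The function \<^const>\<open>phi\<close> is twice continuously differentiable on the positive axis, strictly
  increasing and concave, and its derivative is convex. These properties are inherited from a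
  single dimensionless wave curve, whose shock and rarefaction branches are explicit powers that
  match up to second order (\<open>wave_shape_deriv\<close>, \<open>wave_shape''_mono\<close>).

  The maps \<^const>\<open>p_d\<close> and \<^const>\<open>p_u\<close> return roots of the quadratics that interpolate
  \<^const>\<open>phi\<close> at the ends of a bracket, with a double node at the left or at the right end.
  Convexity of the derivative makes the first quadratic an upper bound of \<^const>\<open>phi\<close> on the
  bracket and the second a lower bound, so both roots stay on their own side of \<^const>\<open>p_star\<close>.
  Concavity makes every step at least as long as the absolute value of \<^const>\<open>phi\<close> at its
  starting point divided by a fixed slope (\<open>p_d_bounds\<close>, \<open>p_u_bounds\<close>). Monotone bounded sequences with such steps converge to
  the root (\<open>iterates_tendsto_root\<close>).

  The hypothesis \<open>\<gamma> \<le> 5 / 3\<close> makes the rarefaction curve lie below the wave curve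
  (\<open>rarefaction_shape_le_wave_shape\<close>). Therefore \<^const>\<open>phi\<close> is nonnegative at
  \<^const>\<open>p_tilde_star\<close>, and the first pair of pressures encloses \<^const>\<open>p_star\<close>.

  The lower, exact and upper speeds are values of one nondecreasing continuous function at the
  left end of the bracket, at \<^const>\<open>p_star\<close> and at the right end. Hence a met tolerance bounds
  the relative error. The exact maximum speed is positive, since the outer waves outrun the fluid
  between them (\<open>extreme_speed_pos\<close>), so the quotient of the upper and the lower speed tends
  to \<open>1\<close> and the tolerance is met after finitely many steps. The safeguard never fires, because
  all pairs up to that point are brackets.
\<close>

section \<open>Bracketing a root by Hermite interpolation\<close>

text \<open>The sign pattern that convexity or concavity of \<^term>\<open>h'\<close> will rule out.\<close>
lemma slopes_at_dip:
  fixes h h' :: "real \<Rightarrow> real"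
  assumes deriv: "\<And>t. p1 \<le> t \<Longrightarrow> (h has_real_derivative h' t) (at t)"
    and zeros: "h p1 = 0" "h p2 = 0" and dip: "p1 \<le> x" "x \<le> p2" "h x < 0"
  obtains y z where "p1 < y" "y < z" "z < p2" "h' y < 0" "h' z > 0"
proof -
  have x: "p1 < x" "x < p2" using zeros dip by (auto simp: order.order_iff_strict)
  have "\<exists>y. y > p1 \<and> y < x \<and> h x - h p1 = (x - p1) * h' y"
    by (rule MVT2) (use x deriv in auto)
  then obtain y where y: "p1 < y" "y < x" "h' y < 0"
    using dip zeros x by (metis diff_zero mult_less_0_iff diff_gt_0_iff_gt less_asym)
  have "\<exists>z. z > x \<and> z < p2 \<and> h p2 - h x = (p2 - x) * h' z"
    by (rule MVT2) (use x deriv in auto)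
  then obtain z where z: "x < z" "z < p2" "h' z > 0"
    using dip zeros x by (metis diff_0 neg_0_less_iff_less zero_less_mult_iff diff_gt_0_iff_gt less_asym)
  show thesis using that[of y z] y z by simp
qed

text \<open>
  A concave quadratic that starts at or below zero and is nonnegative at \<^term>\<open>t\<close> has a root in
  between, which is the quotient below; the slope at the start bounds it from below. The
  discriminant is nonnegative because it dominates \<open>(b + 2 * c * t)\<^sup>2\<close>.
\<close>
lemma smaller_root_bounds:
  fixes a b c t :: real
  assumes "a \<le> 0" "b > 0" "c \<le> 0" "t \<ge> 0" "a + b * t + c * t\<^sup>2 \<ge> 0"
  shows "- a / b \<le> - 2 * a / (b + sqrt (b\<^sup>2 - 4 * a * c))"
    and "- 2 * a / (b + sqrt (b\<^sup>2 - 4 * a * c)) \<le> t"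
proof -
  define r where "r = sqrt (b\<^sup>2 - 4 * a * c)"
  have ac: "a * c \<ge> 0" using assms by (simp add: mult_nonpos_nonpos)
  have "4 * c * (a + b * t + c * t\<^sup>2) \<le> 0"
    by (rule mult_nonpos_nonneg) (use assms in auto)
  hence disc: "(b + 2 * c * t)\<^sup>2 \<le> b\<^sup>2 - 4 * a * c"
    by (simp add: power2_eq_square algebra_simps)
  hence disc0: "0 \<le> b\<^sup>2 - 4 * a * c" by (meson order.trans zero_le_power2)
  have "r \<ge> b + 2 * c * t" unfolding r_def using disc by (rule real_le_rsqrt)
  hence "t * (b + r) \<ge> t * (2 * b + 2 * c * t)"
    using assms by (intro mult_left_mono) auto
  hence "- 2 * a \<le> t * (b + r)" using assms by (simp add: power2_eq_square algebra_simps)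
  moreover have r0: "r \<ge> 0" using disc0 by (simp add: r_def)
  moreover have "r \<le> b"
    unfolding r_def using assms ac by (intro real_le_lsqrt) auto
  ultimately show "- a / b \<le> - 2 * a / (b + sqrt (b\<^sup>2 - 4 * a * c))"
    and "- 2 * a / (b + sqrt (b\<^sup>2 - 4 * a * c)) \<le> t"
    unfolding r_def[symmetric] using assms
      mult_left_mono_neg[of "b + r" "2 * b" a]
    by (simp_all add: divide_simps)
qed

text \<open>
  Here \<^term>\<open>d\<close> is the distance from the right node to the root on its left. Since
  \<open>b * t - c * t\<^sup>2\<close> increases strictly for \<open>t \<ge> 0\<close>, the sign of the quadratic at \<^term>\<open>t\<close>
  tells on which side of \<^term>\<open>d\<close> the point \<^term>\<open>t\<close> lies.
\<close>
lemma larger_root_compare: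
  fixes a b c t :: real
  assumes "a \<ge> 0" "b > 0" "c \<le> 0" "t \<ge> 0"
  defines "d \<equiv> 2 * a / (b + sqrt (b\<^sup>2 - 4 * a * c))"
  shows "a - b * t + c * t\<^sup>2 \<le> 0 \<Longrightarrow> d \<le> t"
    and "a - b * t + c * t\<^sup>2 \<ge> 0 \<Longrightarrow> t \<le> d"
proof -
  define r where "r = sqrt (b\<^sup>2 - 4 * a * c)"
  have "a * c \<le> 0" using assms by (simp add: mult_nonneg_nonpos)
  hence disc: "b\<^sup>2 - 4 * a * c \<ge> 0" using zero_le_power2[of b] by linarith
  have r: "r \<ge> 0" "r\<^sup>2 = b\<^sup>2 - 4 * a * c" using disc by (auto simp: r_def)
  have "b + r > 0" using assms r by simp
  hence d: "d \<ge> 0" "d * (b + r) = 2 * a" using assms(1) by (simp_all add: d_def r_def[symmetric])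
  have "(b * d - c * d\<^sup>2) * (b + r)\<^sup>2 = b * (d * (b + r)) * (b + r) - c * (d * (b + r))\<^sup>2"
    by (simp add: power2_eq_square algebra_simps)
  also have "\<dots> = a * (2 * b\<^sup>2 + 2 * b * r - 4 * a * c)"
    by (simp only: d) (simp add: power2_eq_square algebra_simps)
  also have "2 * b\<^sup>2 + 2 * b * r - 4 * a * c = (b + r)\<^sup>2"
    using r by (simp add: power2_sum)
  finally have root: "b * d - c * d\<^sup>2 = a" using assms r by simp
  have mono: "b * x - c * x\<^sup>2 < b * y - c * y\<^sup>2" if "0 \<le> x" "x < y" for x y
  proof -
    have "c * y\<^sup>2 \<le> c * x\<^sup>2" using assms that by (intro mult_left_mono_neg power_mono) auto
    moreover have "b * x < b * y" using assms that by simp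
    ultimately show ?thesis by linarith
  qed
  show "d \<le> t" if "a - b * t + c * t\<^sup>2 \<le> 0"
    using mono[of t d] that root assms(4) by fastforce
  show "t \<le> d" if "a - b * t + c * t\<^sup>2 \<ge> 0"
    using mono[of d t] that root d by fastforce
qed

text \<open>
  All that the bracketing iteration needs to know about \<^const>\<open>phi\<close>. Convexity of
  \<^term>\<open>g'\<close> stands for a nonnegative third derivative; in this form it tolerates the jumps of
  the third derivative of \<^const>\<open>phi\<close> at the two data pressures.
\<close>
locale bracketed_root =
  fixes g g' :: "real \<Rightarrow> real" and s :: real
  assumes deriv_g: "x > 0 \<Longrightarrow> (g has_real_derivative g' x) (at x)"
    and deriv_pos: "x > 0 \<Longrightarrow> g' x > 0"
    and deriv_antimono: "0 < x \<Longrightarrow> x \<le> y \<Longrightarrow> g' y \<le> g' x"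
    and deriv_convex: "convex_on {0<..} g'"
    and root_pos: "s > 0" and root: "g s = 0"
begin

lemma deriv_eq: "x > 0 \<Longrightarrow> deriv g x = g' x"
  using deriv_g DERIV_imp_deriv by blast

lemma strict_mono: "0 < x \<Longrightarrow> x < y \<Longrightarrow> g x < g y"
  by (rule DERIV_pos_imp_increasing[where f = g])
    (auto intro!: exI[of _ "g' t" for t] deriv_g deriv_pos)

lemma nonpos_iff: "x > 0 \<Longrightarrow> g x \<le> 0 \<longleftrightarrow> x \<le> s"
  using strict_mono[of x s] strict_mono[of s x] root root_pos by fastforce

lemma nonneg_iff: "x > 0 \<Longrightarrow> g x \<ge> 0 \<longleftrightarrow> s \<le> x"
  using strict_mono[of x s] strict_mono[of s x] root root_pos by fastforce

lemma divdiff_mean_value: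
  assumes "0 < x" "x < y"
  obtains z where "x < z" "z < y" "divdiff g x y = g' z"
proof -
  have "\<exists>z. z > x \<and> z < y \<and> g y - g x = (y - x) * g' z"
    by (rule MVT2) (use assms deriv_g in auto)
  then show thesis using that assms by (auto simp: divdiff_def)
qed

lemma divdiff_bounds:
  assumes "0 < x" "x < y"
  shows "g' y \<le> divdiff g x y" "divdiff g x y \<le> g' x"
  using divdiff_mean_value[OF assms] deriv_antimono assms
  by (metis less_eq_real_def order.strict_trans)+

lemma divdiff_112_nonpos: "0 < x \<Longrightarrow> x < y \<Longrightarrow> divdiff_112 g x y \<le> 0"
  using divdiff_bounds[of x y] by (simp add: divdiff_112_def deriv_eq divide_le_0_iff)

lemma divdiff_122_nonpos: "0 < x \<Longrightarrow> x < y \<Longrightarrow> divdiff_122 g x y \<le> 0"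
  using divdiff_bounds[of x y] by (simp add: divdiff_122_def deriv_eq divide_le_0_iff)

text \<open>Convexity of \<^term>\<open>g'\<close> with the denominator cleared.\<close>
lemma deriv_between:
  assumes "0 < x" "x < y" "y < z"
  shows "g' y * (z - x) \<le> g' x * (z - y) + g' z * (y - x)"
proof -
  define t where "t = (y - x) / (z - x)"
  have t: "0 \<le> t" "t \<le> 1" using assms by (auto simp: t_def)
  have "y - x = t * (z - x)" using assms by (simp add: t_def)
  hence y: "y = (1 - t) * x + t * z" by (simp add: algebra_simps)
  have "g' y \<le> (1 - t) * g' x + t * g' z"
    using convex_onD[OF deriv_convex t, of x z] assms y by simp
  hence "g' y * (z - x) \<le> ((1 - t) * g' x + t * g' z) * (z - x)"
    using assms by (simp add: mult_right_mono)
  also have "\<dots> = g' x * (z - y) + g' z * (y - x)"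
    by (subst y)+ (simp add: algebra_simps y)
  finally show ?thesis .
qed

lemma divdiff_112_eq:
  assumes "0 < x" "x < y"
  shows "divdiff_112 g x y * (y - x)\<^sup>2 = g y - g x - g' x * (y - x)"
proof -
  have "(d / h - e) / h * h\<^sup>2 = d - e * h" if "h \<noteq> 0" for d e h :: real
    using that by (simp add: power2_eq_square field_simps)
  from this[of "y - x" "g y - g x" "g' x"] show ?thesis
    using assms by (simp add: divdiff_112_def divdiff_def deriv_eq)
qed

lemma divdiff_122_eq:
  assumes "0 < x" "x < y"
  shows "divdiff_122 g x y * (y - x)\<^sup>2 = g' y * (y - x) - (g y - g x)"
proof -
  have "(e - d / h) / h * h\<^sup>2 = e * h - d" if "h \<noteq> 0" for d e h :: real
    using that by (simp add: power2_eq_square field_simps)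
  from this[of "y - x" "g' y" "g y - g x"] show ?thesis
    using assms by (simp add: divdiff_122_def divdiff_def deriv_eq)
qed

text \<open>
  The quadratic on the right is the Hermite interpolant with a double node at \<^term>\<open>p1\<close>; call
  it \<open>q\<close>. The slope of \<open>q - g\<close> is concave and vanishes at \<^term>\<open>p1\<close>, so once negative it
  stays negative. Hence \<open>q - g\<close>, being zero at both ends, cannot dip below zero in between.
\<close>
lemma le_hermite_double_left:
  assumes "0 < p1" "p1 \<le> x" "x \<le> p2" "p1 < p2"
  shows "g x \<le> g p1 + g' p1 * (x - p1) + divdiff_112 g p1 p2 * (x - p1)\<^sup>2"
proof (rule ccontr)
  define c where "c = divdiff_112 g p1 p2"
  define h where "h = (\<lambda>t. g p1 + g' p1 * (t - p1) + c * (t - p1)\<^sup>2 - g t)"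
  define h' where "h' = (\<lambda>t. g' p1 + 2 * c * (t - p1) - g' t)"
  have h_deriv: "(h has_real_derivative h' t) (at t)" if "p1 \<le> t" for t
    unfolding h_def h'_def using assms that by (auto intro!: derivative_eq_intros deriv_g)
  have h_p1: "h p1 = 0" by (simp add: h_def)
  have h_p2: "h p2 = 0"
    using divdiff_112_eq[of p1 p2] assms by (simp add: h_def c_def)
  assume "\<not> ?thesis"
  hence "h x < 0" by (simp add: h_def c_def)
  with h_deriv h_p1 h_p2 assms(2,3)
  obtain y z where yz: "p1 < y" "y < z" "z < p2" "h' y < 0" "h' z > 0"
    by (rule slopes_at_dip[of p1 h h' p2 x])
  have "g' y * (z - p1) \<le> g' p1 * (z - y) + g' z * (y - p1)"
    using deriv_between[of p1 y z] assms yz by simp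
  hence "h' z * (y - p1) \<le> h' y * (z - p1)"
    by (simp add: h'_def algebra_simps)
  moreover have "h' z * (y - p1) > 0" "h' y * (z - p1) < 0"
    using yz by (auto simp: mult_neg_pos)
  ultimately show False by linarith
qed

text \<open>
  The mirror image, with the double node at \<^term>\<open>p2\<close>: now the slope of the difference is
  convex and vanishes at the right end, which excludes a positive value to the right of a
  negative one.
\<close>
lemma hermite_double_right_le:
  assumes "0 < p1" "p1 \<le> x" "x \<le> p2" "p1 < p2"
  shows "g p2 + g' p2 * (x - p2) + divdiff_122 g p1 p2 * (x - p2)\<^sup>2 \<le> g x"
proof (rule ccontr)
  define c where "c = divdiff_122 g p1 p2"
  define h where "h = (\<lambda>t. g t - (g p2 + g' p2 * (t - p2) + c * (t - p2)\<^sup>2))"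
  define h' where "h' = (\<lambda>t. g' t - (g' p2 + 2 * c * (t - p2)))"
  have h_deriv: "(h has_real_derivative h' t) (at t)" if "p1 \<le> t" for t
    unfolding h_def h'_def using assms that by (auto intro!: derivative_eq_intros deriv_g)
  have h_p2: "h p2 = 0" by (simp add: h_def)
  have h_p1: "h p1 = 0"
    using divdiff_122_eq[of p1 p2] assms
    by (simp add: h_def c_def power2_commute[of p1 p2] right_diff_distrib)
  assume "\<not> ?thesis"
  hence "h x < 0" by (simp add: h_def c_def)
  with h_deriv h_p1 h_p2 assms(2,3)
  obtain y z where yz: "p1 < y" "y < z" "z < p2" "h' y < 0" "h' z > 0"
    by (rule slopes_at_dip[of p1 h h' p2 x])
  have "g' z * (p2 - y) \<le> g' y * (p2 - z) + g' p2 * (z - y)"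
    using deriv_between[of y z p2] assms yz by simp
  hence "h' z * (p2 - y) \<le> h' y * (p2 - z)"
    by (simp add: h'_def algebra_simps)
  moreover have "h' z * (p2 - y) > 0" "h' y * (p2 - z) < 0"
    using yz by (auto simp: mult_neg_pos)
  ultimately show False by linarith
qed

text \<open>
  The quadratic behind \<^const>\<open>p_d\<close> lies above \<^term>\<open>g\<close>, so it is already nonnegative at the
  root \<^term>\<open>s\<close> and its own root does not overshoot. Being concave it lies below its tangent at
  \<^term>\<open>p1\<close>, so the step is at least the Newton step.
\<close>
lemma p_d_bounds:
  assumes "0 < p1" "p1 \<le> s" "s \<le> p2" "p1 < p2"
  shows "p1 - g p1 / g' p1 \<le> p_d g p1 p2" "p_d g p1 p2 \<le> s"
proof -
  have "g p1 \<le> 0" using assms nonpos_iff by auto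
  moreover have "0 \<le> g p1 + g' p1 * (s - p1) + divdiff_112 g p1 p2 * (s - p1)\<^sup>2"
    using le_hermite_double_left[of p1 s p2] assms root by simp
  ultimately show "p1 - g p1 / g' p1 \<le> p_d g p1 p2" "p_d g p1 p2 \<le> s"
    using smaller_root_bounds[of "g p1" "g' p1" "divdiff_112 g p1 p2" "s - p1"]
      deriv_pos[of p1] divdiff_112_nonpos[of p1 p2] assms
    by (auto simp: p_d_def deriv_eq)
qed

text \<open>
  The quadratic behind \<^const>\<open>p_u\<close> lies below \<^term>\<open>g\<close>, so its root does not undershoot. It is
  concave, hence lies above its chord, so the step is at least the secant step; the chord in
  turn is no steeper than \<^term>\<open>g' p1\<close>.
\<close>
lemma p_u_bounds:
  assumes "0 < p1" "p1 \<le> s" "s \<le> p2" "p1 < p2"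
  shows "s \<le> p_u g p1 p2" "p_u g p1 p2 \<le> p2 - g p2 / g' p1"
proof -
  define a b c where "a = g p2" and "b = g' p2" and "c = divdiff_122 g p1 p2"
  define S where "S = divdiff g p1 p2"
  have p2: "p2 > 0" using assms by simp
  have a: "a \<ge> 0" using assms nonneg_iff p2 by (auto simp: a_def)
  have b: "b > 0" using deriv_pos p2 by (simp add: b_def)
  have c: "c \<le> 0" using divdiff_122_nonpos assms by (simp add: c_def)
  have pu: "p_u g p1 p2 = p2 - 2 * a / (b + sqrt (b\<^sup>2 - 4 * a * c))"
    using p2 by (simp add: p_u_def a_def b_def c_def deriv_eq)
  have "a + b * (s - p2) + c * (s - p2)\<^sup>2 \<le> 0"
    using hermite_double_right_le[of p1 s p2] assms root by (simp add: a_def b_def c_def)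
  hence "a - b * (p2 - s) + c * (p2 - s)\<^sup>2 \<le> 0"
    by (simp add: power2_commute[of s p2] algebra_simps)
  from larger_root_compare(1)[OF a b c _ this] assms
  show "s \<le> p_u g p1 p2" by (simp add: pu)
  have S: "S > 0" "S \<le> g' p1" using divdiff_bounds[of p1 p2] assms b
    by (auto simp: S_def b_def)
  have bS: "b = S + c * (p2 - p1)"
    using assms p2 by (simp add: b_def c_def S_def divdiff_122_def deriv_eq)
  \<comment> \<open>\<^term>\<open>t\<close> is the secant step, measured leftwards from \<^term>\<open>p2\<close>.\<close>
  define t where "t = a / S"
  have "S * (p2 - p1) = a - g p1" using assms by (simp add: S_def divdiff_def a_def)
  hence "a \<le> S * (p2 - p1)" using assms nonpos_iff[of p1] by simp
  hence t: "0 \<le> t" "t \<le> p2 - p1" using a S by (auto simp: t_def divide_simps mult.commute)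
  have "a - b * t + c * t\<^sup>2 = (a - S * t) + c * (t * (t - (p2 - p1)))"
    by (simp add: bS power2_eq_square algebra_simps)
  also have "a - S * t = 0" using S by (simp add: t_def)
  also have "0 + c * (t * (t - (p2 - p1))) \<ge> 0"
    using c t by (simp add: mult_nonpos_nonpos mult_nonneg_nonpos)
  finally have "t \<le> 2 * a / (b + sqrt (b\<^sup>2 - 4 * a * c))"
    using larger_root_compare(2)[OF a b c t(1)] by simp
  moreover have "g p2 / g' p1 \<le> t"
    unfolding t_def a_def[symmetric] using S a by (simp add: frac_le)
  ultimately show "p_u g p1 p2 \<le> p2 - g p2 / g' p1" by (simp add: pu)
qed

lemma step_bounds:
  assumes "0 < p1" "p1 \<le> s" "s \<le> p2" "p1 < p2"
  shows "p1 \<le> p_d g p1 p2" "p_d g p1 p2 \<le> s" "s \<le> p_u g p1 p2" "p_u g p1 p2 \<le> p2"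
proof -
  have "g p1 / g' p1 \<le> 0" "g p2 / g' p1 \<ge> 0"
    using assms nonpos_iff[of p1] nonneg_iff[of p2] deriv_pos[of p1]
    by (auto simp: divide_le_0_iff)
  thus "p1 \<le> p_d g p1 p2" "p_d g p1 p2 \<le> s" "s \<le> p_u g p1 p2" "p_u g p1 p2 \<le> p2"
    using p_d_bounds[OF assms] p_u_bounds[OF assms] by simp_all
qed

text \<open>The tangent of a concave function lies above it, so a Newton step from the right overshoots.\<close>
lemma newton_le_root:
  assumes "s \<le> p" shows "p - g p / g' p \<le> s"
proof (cases "s = p")
  case True then show ?thesis using root by simp
next
  case False
  hence "s < p" using assms by simp
  hence "g' p * (p - s) \<le> g p"
    using divdiff_bounds(1)[OF root_pos] root by (simp add: divdiff_def pos_le_divide_eq)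
  thus ?thesis using deriv_pos[of p] \<open>s < p\<close> root_pos by (simp add: field_simps)
qed

lemma continuous_at_pos: "x > 0 \<Longrightarrow> isCont g x"
  using deriv_g DERIV_isCont by blast

text \<open>
  Both sequences are monotone and bounded, hence converge. Every step has length at least
  \<open>\<bar>g\<bar> / M\<close>, where \<open>M\<close> is the slope at the first left end, the largest slope that occurs; as the
  steps tend to zero, so do the values of \<^term>\<open>g\<close>, and both limits are zeros of \<^term>\<open>g\<close>.
\<close>
lemma iterates_tendsto_root:
  fixes x y :: "nat \<Rightarrow> real"
  assumes start: "0 < x 0" "x 0 \<le> s" "s \<le> y 0"
    and distinct: "\<And>k. x k \<noteq> y k"
    and step: "\<And>k. x (Suc k) = p_d g (x k) (y k)" "\<And>k. y (Suc k) = p_u g (x k) (y k)"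
  shows "x \<longlonglongrightarrow> s" "y \<longlonglongrightarrow> s"
proof -
  have xinc: "x k \<le> x (Suc k)" and inv: "0 < x k \<and> x k \<le> s \<and> s \<le> y k"
    and ydec: "y (Suc k) \<le> y k" for k
  proof -
    have prog: "x k \<le> x (Suc k) \<and> x (Suc k) \<le> s \<and> s \<le> y (Suc k) \<and> y (Suc k) \<le> y k"
      if "0 < x k \<and> x k \<le> s \<and> s \<le> y k" for k
    proof -
      have lt: "x k < y k" using that distinct[of k] by simp
      show ?thesis using step_bounds[of "x k" "y k"] that lt step by simp
    qed
    have all: "0 < x k \<and> x k \<le> s \<and> s \<le> y k" for k
      by (induction k) (use start prog in \<open>auto intro: less_le_trans\<close>)
    show "x k \<le> x (Suc k)" "0 < x k \<and> x k \<le> s \<and> s \<le> y k" "y (Suc k) \<le> y k"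
      using all[of k] prog[of k] by auto
  qed
  have "incseq x" using xinc by (rule incseq_SucI)
  have "decseq y" using ydec by (rule decseq_SucI)
  obtain P where P: "x \<longlonglongrightarrow> P" "\<And>k. x k \<le> P"
    using incseq_convergent[OF \<open>incseq x\<close>, of s] inv by blast
  obtain Q where Q: "y \<longlonglongrightarrow> Q" "\<And>k. Q \<le> y k"
    using decseq_convergent[OF \<open>decseq y\<close>, of s] inv by blast
  have P0: "P > 0" using P(2)[of 0] start by simp
  have Q0: "Q > 0" using LIMSEQ_le_const[OF Q(1), of s] inv root_pos by force
  define M where "M = g' (x 0)"
  have M: "M > 0" using deriv_pos start by (simp add: M_def)
  have slope: "g' (x k) \<le> M" "0 < g' (x k)" for k
    using deriv_antimono[of "x 0" "x k"] incseqD[OF \<open>incseq x\<close>, of 0 k] start inv[of k] deriv_pos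
    by (auto simp: M_def)
  have gx: "- g (x k) \<le> M * (x (Suc k) - x k)" for k
  proof -
    have "- g (x k) / M \<le> - g (x k) / g' (x k)"
      using slope[of k] inv[of k] nonpos_iff[of "x k"] M by (intro divide_left_mono) auto
    also have "\<dots> \<le> x (Suc k) - x k"
      using p_d_bounds(1)[of "x k" "y k"] inv[of k] distinct[of k] step by simp
    finally show ?thesis using M by (simp add: divide_simps mult.commute)
  qed
  have gy: "g (y k) \<le> M * (y k - y (Suc k))" for k
  proof -
    have "g (y k) / M \<le> g (y k) / g' (x k)"
      using slope[of k] inv[of k] nonneg_iff[of "y k"] M by (intro divide_left_mono) auto
    also have "\<dots> \<le> y k - y (Suc k)"
      using p_u_bounds(2)[of "x k" "y k"] inv[of k] distinct[of k] step by simp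
    finally show ?thesis using M by (simp add: divide_simps mult.commute)
  qed
  have "(\<lambda>k. M * (x (Suc k) - x k)) \<longlonglongrightarrow> M * (P - P)"
    by (intro tendsto_intros P(1) LIMSEQ_Suc)
  moreover have "(\<lambda>k. - g (x k)) \<longlonglongrightarrow> - g P"
    using isCont_tendsto_compose[OF continuous_at_pos[OF P0] P(1)] by (rule tendsto_minus)
  ultimately have "- g P \<le> M * (P - P)"
    using gx LIMSEQ_le by blast
  hence "s \<le> P" using nonneg_iff P0 by simp
  moreover have "P \<le> s" using LIMSEQ_le_const2[OF P(1)] inv by blast
  ultimately show "x \<longlonglongrightarrow> s" using P(1) by simp
  have "(\<lambda>k. M * (y k - y (Suc k))) \<longlonglongrightarrow> M * (Q - Q)"
    by (intro tendsto_intros Q(1) LIMSEQ_Suc)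
  moreover have "(\<lambda>k. g (y k)) \<longlonglongrightarrow> g Q"
    using isCont_tendsto_compose[OF continuous_at_pos[OF Q0] Q(1)] .
  ultimately have "g Q \<le> M * (Q - Q)"
    using gy LIMSEQ_le by blast
  hence "Q \<le> s" using nonpos_iff Q0 by simp
  moreover have "s \<le> Q" using LIMSEQ_le_const[OF Q(1)] inv by blast
  ultimately show "y \<longlonglongrightarrow> s" using Q(1) by simp
qed

end

section \<open>The dimensionless wave curve\<close>

lemma has_real_derivative_If:
  fixes f g :: "real \<Rightarrow> real"
  assumes "x \<ge> c \<Longrightarrow> (f has_real_derivative D) (at x)"
    and "x \<le> c \<Longrightarrow> (g has_real_derivative D) (at x)"
    and "f c = g c"
  shows "((\<lambda>t. if t \<ge> c then f t else g t) has_real_derivative D) (at x)"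
proof -
  have "((\<lambda>t. if t \<in> {c..} then f t else g t) has_derivative (if x \<in> {c..} then (*) D else (*) D))
      (at x within {c..} \<union> {..<c})"
  proof (rule has_derivative_If_within_closures[where f' = "\<lambda>_. (*) D" and g' = "\<lambda>_. (*) D"])
    assume "x \<in> {c..} \<union> (closure {c..} \<inter> closure {..<c})"
    thus "(f has_derivative (*) D) (at x within {c..} \<union> (closure {c..} \<inter> closure {..<c}))"
      using assms(1) by (auto simp: has_field_derivative_def intro: has_derivative_at_withinI)
  next
    assume "x \<in> {..<c} \<union> (closure {c..} \<inter> closure {..<c})"
    thus "(g has_derivative (*) D) (at x within {..<c} \<union> (closure {c..} \<inter> closure {..<c}))"
      using assms(2) by (auto simp: has_field_derivative_def intro: has_derivative_at_withinI)
  qed (use assms(3) in auto)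
  moreover have "{c..} \<union> {..<c} = (UNIV :: real set)" by auto
  ultimately show ?thesis by (simp add: has_field_derivative_def)
qed

text \<open>
  After scaling pressure by the pressure of the state and velocity by a suitable factor, the wave
  curve depends on \<open>\<gamma>\<close> only through \<open>\<beta> = (\<gamma> + 1) / (2 * \<gamma>)\<close>. The rarefaction branch is then the
  primitive of \<open>x powr (- \<beta>)\<close> that vanishes at 1.
\<close>
definition shock_shape :: "real \<Rightarrow> real \<Rightarrow> real" where
  "shock_shape \<beta> x = (x - 1) / sqrt (1 + \<beta> * (x - 1))"

definition rarefaction_shape :: "real \<Rightarrow> real \<Rightarrow> real" where
  "rarefaction_shape \<beta> x = (x powr (1 - \<beta>) - 1) / (1 - \<beta>)"

definition wave_shape :: "real \<Rightarrow> real \<Rightarrow> real" where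
  "wave_shape \<beta> x = (if x \<ge> 1 then shock_shape \<beta> x else rarefaction_shape \<beta> x)"

definition shock_shape' :: "real \<Rightarrow> real \<Rightarrow> real" where
  "shock_shape' \<beta> x = ((1 + \<beta> * (x - 1)) powr (-1/2) + (1 + \<beta> * (x - 1)) powr (-3/2)) / 2"

definition wave_shape' :: "real \<Rightarrow> real \<Rightarrow> real" where
  "wave_shape' \<beta> x = (if x \<ge> 1 then shock_shape' \<beta> x else x powr (- \<beta>))"

definition wave_shape'' :: "real \<Rightarrow> real \<Rightarrow> real" where
  "wave_shape'' \<beta> x =
     (if x \<ge> 1 then - \<beta> / 4 * ((1 + \<beta> * (x - 1)) powr (-3/2) + 3 * (1 + \<beta> * (x - 1)) powr (-5/2))
      else - \<beta> * x powr (- \<beta> - 1))"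

text \<open>As a combination of powers the shock branch can be differentiated termwise.\<close>
lemma shock_shape_eq_powr:
  assumes "\<beta> > 0" "1 + \<beta> * (x - 1) > 0"
  shows "shock_shape \<beta> x = ((1 + \<beta> * (x - 1)) powr (1/2) - (1 + \<beta> * (x - 1)) powr (-1/2)) / \<beta>"
proof -
  define Y where "Y = 1 + \<beta> * (x - 1)"
  have Y: "Y > 0" using assms by (simp add: Y_def)
  have "Y powr (-1/2) = 1 / sqrt Y"
    using Y by (simp add: powr_half_sqrt[symmetric] powr_minus_divide[symmetric])
  moreover have "Y powr (1/2) = Y / sqrt Y"
    using Y by (simp add: powr_half_sqrt real_div_sqrt)
  moreover have "shock_shape \<beta> x = (Y - 1) / \<beta> / sqrt Y"
    using assms by (simp add: shock_shape_def Y_def)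
  ultimately show ?thesis
    unfolding Y_def[symmetric] by (simp add: diff_divide_distrib mult.commute)
qed

lemma shock_shape_deriv:
  assumes "0 < \<beta>" "\<beta> < 1" "x \<ge> 1"
  shows "(shock_shape \<beta> has_real_derivative shock_shape' \<beta> x) (at x)"
proof -
  have Y: "1 + \<beta> * (x - 1) > 0" using assms by (simp add: add_pos_nonneg)
  have "((\<lambda>x. ((1 + \<beta> * (x - 1)) powr (1/2) - (1 + \<beta> * (x - 1)) powr (-1/2)) / \<beta>)
      has_real_derivative shock_shape' \<beta> x) (at x)"
    using assms Y by (auto intro!: derivative_eq_intros simp: shock_shape'_def field_simps powr_diff)
  moreover have "eventually (\<lambda>x. 1 + \<beta> * (x - 1) > 0) (nhds x)"
    using Y by (intro order_tendstoD(1)[OF _ Y]) (auto intro!: tendsto_eq_intros filterlim_ident)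
  hence "eventually (\<lambda>x. shock_shape \<beta> x =
      ((1 + \<beta> * (x - 1)) powr (1/2) - (1 + \<beta> * (x - 1)) powr (-1/2)) / \<beta>) (nhds x)"
    by eventually_elim (use shock_shape_eq_powr assms in auto)
  ultimately show ?thesis by (subst DERIV_cong_ev[OF refl _ refl])
qed

lemma rarefaction_shape_deriv:
  assumes "\<beta> < 1" "x > 0"
  shows "(rarefaction_shape \<beta> has_real_derivative x powr (- \<beta>)) (at x)"
  unfolding rarefaction_shape_def using assms
  by (auto intro!: derivative_eq_intros)

text \<open>
  At \<open>x = 1\<close> the two branches share value, slope \<open>1\<close> and second derivative \<open>- \<beta>\<close>, so the
  derivative formulas of the branches extend across the junction.
\<close>
lemma wave_shape_deriv:
  assumes "0 < \<beta>" "\<beta> < 1" "x > 0"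
  shows "(wave_shape \<beta> has_real_derivative wave_shape' \<beta> x) (at x)"
proof -
  have "((\<lambda>x. if x \<ge> 1 then shock_shape \<beta> x else rarefaction_shape \<beta> x)
      has_real_derivative wave_shape' \<beta> x) (at x)"
  proof (rule has_real_derivative_If)
    show "(shock_shape \<beta> has_real_derivative wave_shape' \<beta> x) (at x)" if "1 \<le> x"
      using shock_shape_deriv[of \<beta> x] that assms by (simp add: wave_shape'_def)
    show "(rarefaction_shape \<beta> has_real_derivative wave_shape' \<beta> x) (at x)" if "x \<le> 1"
      using rarefaction_shape_deriv[of \<beta> x] that assms
      by (cases "x = 1") (auto simp: wave_shape'_def shock_shape'_def)
  qed (simp add: shock_shape_def rarefaction_shape_def)
  thus ?thesis by (simp add: wave_shape_def[abs_def])
qed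

lemma wave_shape'_deriv:
  assumes "0 < \<beta>" "\<beta> < 1" "x > 0"
  shows "(wave_shape' \<beta> has_real_derivative wave_shape'' \<beta> x) (at x)"
proof -
  have "((\<lambda>x. if x \<ge> 1 then shock_shape' \<beta> x else x powr (- \<beta>))
      has_real_derivative wave_shape'' \<beta> x) (at x)"
  proof (rule has_real_derivative_If)
    show "(shock_shape' \<beta> has_real_derivative wave_shape'' \<beta> x) (at x)" if "1 \<le> x"
    proof -
      have Y: "1 + \<beta> * (x - 1) > 0" using assms that by (simp add: add_pos_nonneg)
      show ?thesis using assms Y that unfolding shock_shape'_def[abs_def]
        by (auto intro!: derivative_eq_intros simp: wave_shape''_def field_simps)
    qed
    show "((\<lambda>x. x powr (- \<beta>)) has_real_derivative wave_shape'' \<beta> x) (at x)" if "x \<le> 1"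
      using that assms by (cases "x = 1") (auto intro!: derivative_eq_intros simp: wave_shape''_def)
  qed (simp add: shock_shape'_def)
  thus ?thesis by (simp add: wave_shape'_def[abs_def])
qed

lemma wave_shape'_pos:
  assumes "0 < \<beta>" "x > 0" shows "wave_shape' \<beta> x > 0"
proof (cases "x \<ge> 1")
  case True
  hence "1 + \<beta> * (x - 1) > 0" using assms by (simp add: add_pos_nonneg)
  thus ?thesis using True by (simp add: wave_shape'_def shock_shape'_def add_pos_pos)
qed (use assms in \<open>simp add: wave_shape'_def\<close>)

lemma wave_shape''_nonpos:
  assumes "0 < \<beta>" "x > 0" shows "wave_shape'' \<beta> x \<le> 0"
  using assms by (auto simp: wave_shape''_def mult_nonpos_nonneg intro!: add_nonneg_nonneg)

text \<open>
  On each branch this is the monotonicity of negative powers; because the branches agree at \<open>1\<close>,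
  the comparison can be chained through that point.
\<close>
lemma wave_shape''_mono:
  assumes \<beta>: "0 < \<beta>" and x: "0 < x" "x \<le> y"
  shows "wave_shape'' \<beta> x \<le> wave_shape'' \<beta> y"
proof -
  have shock: "wave_shape'' \<beta> x \<le> wave_shape'' \<beta> y" if "1 \<le> x" "x \<le> y" for x y
  proof -
    have "0 < 1 + \<beta> * (x - 1)" "1 + \<beta> * (x - 1) \<le> 1 + \<beta> * (y - 1)"
      using that \<beta> by (auto intro: add_pos_nonneg)
    hence "(1 + \<beta> * (y - 1)) powr (-3/2) \<le> (1 + \<beta> * (x - 1)) powr (-3/2)"
      "(1 + \<beta> * (y - 1)) powr (-5/2) \<le> (1 + \<beta> * (x - 1)) powr (-5/2)"
      by (auto intro!: powr_mono2')
    thus ?thesis using \<beta> that unfolding wave_shape''_def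
      by (auto intro!: mult_left_mono_neg add_mono mult_left_mono)
  qed
  have rare: "wave_shape'' \<beta> x \<le> wave_shape'' \<beta> y" if "0 < x" "x \<le> y" "y \<le> 1" for x y
  proof -
    have eq: "wave_shape'' \<beta> t = - \<beta> * t powr (- \<beta> - 1)" if "0 < t" "t \<le> 1" for t
      using that by (cases "t = 1") (auto simp: wave_shape''_def)
    have "y powr (- \<beta> - 1) \<le> x powr (- \<beta> - 1)"
      using that \<beta> by (intro powr_mono2') auto
    thus ?thesis using \<beta> that by (simp add: eq)
  qed
  show ?thesis
    using shock[of x y] rare[of x y] rare[of x 1] shock[of 1 y] x
    by (meson linorder_le_cases order.trans order.refl)
qed

text \<open>
  This is where \<open>\<gamma> \<le> 5 / 3\<close>, that is \<open>\<beta> \<ge> 4 / 5\<close>, enters. With \<open>Y = 1 + \<beta> * (x - 1)\<close> the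
  claim is \<open>x powr (- \<beta>) \<le> (1 + Y) / 2 * Y powr (- 3/2)\<close>. Both sides agree at \<open>x = 1\<close>; the
  logarithm \<open>h\<close> of their quotient has a derivative whose sign, for \<open>\<beta> = 4 / 5\<close>, reduces to that of
  \<open>3 * (Y - 1)\<^sup>2\<close>, and larger values of \<open>\<beta>\<close> only help.
\<close>
lemma rarefaction_slope_le_shock_slope:
  assumes \<beta>: "4/5 \<le> \<beta>" "\<beta> < 1" and x: "x \<ge> 1"
  shows "x powr (- \<beta>) \<le> shock_shape' \<beta> x"
proof -
  define Y where "Y = (\<lambda>x. 1 + \<beta> * (x - 1))"
  define h where "h = (\<lambda>x. ln ((1 + Y x) / 2) - 3/2 * ln (Y x) + \<beta> * ln x)"
  have Y1: "Y t \<ge> 1" if "t \<ge> 1" for t using that \<beta> by (simp add: Y_def)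
  have "h 1 \<le> h x"
  proof (rule DERIV_nonneg_imp_nondecreasing[OF x])
    fix t :: real assume t: "1 \<le> t"
    define y where "y = Y t - 1"
    have y: "y \<ge> 0" using Y1[OF t] by (simp add: y_def)
    have ty: "\<beta> * t = \<beta> + y" by (simp add: y_def Y_def algebra_simps)
    have "(h has_real_derivative (\<beta> / (1 + Y t) - 3/2 * (\<beta> / Y t) + \<beta> / t)) (at t)"
    proof -
      have "(Y has_real_derivative \<beta>) (at t)"
        unfolding Y_def by (auto intro!: derivative_eq_intros)
      moreover have "1 + Y t > 0" "Y t > 0" "t > 0" using Y1[OF t] t by auto
      ultimately show ?thesis unfolding h_def
        by (auto intro!: derivative_eq_intros) (simp add: divide_simps)
    qed
    moreover have "\<beta> / (1 + Y t) - 3/2 * (\<beta> / Y t) + \<beta> / t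
        = \<beta> * (1 / (2 + y) - 3 / (2 * (1 + y)) + 1 / t)"
      by (simp add: y_def algebra_simps)
    moreover have "1 / (2 + y) - 3 / (2 * (1 + y)) + 1 / t \<ge> 0"
    proof -
      \<comment> \<open>Since \<open>t = 1 + y / \<beta>\<close>, the smallest value of \<open>1 / t\<close> belongs to \<open>\<beta> = 4 / 5\<close>.\<close>
      have "4 * t \<le> 4 + 5 * y"
      proof -
        have "4/5 * (t - 1) \<le> \<beta> * (t - 1)" using \<beta> t by (intro mult_right_mono) auto
        thus ?thesis by (simp add: y_def Y_def)
      qed
      hence "4 / (4 + 5 * y) \<le> 1 / t" using t y by (simp add: field_simps)
      moreover have "1 / (2 + y) - 3 / (2 * (1 + y)) + 4 / (4 + 5 * y)
          = 3 * y\<^sup>2 / (2 * (2 + y) * (1 + y) * (4 + 5 * y))"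
        using y by (simp add: divide_simps add_pos_nonneg) (simp add: power2_eq_square algebra_simps)
      moreover have "\<dots> \<ge> 0" using y by simp
      ultimately show ?thesis by linarith
    qed
    ultimately show "\<exists>d. (h has_real_derivative d) (at t) \<and> d \<ge> 0"
      using \<beta> by (intro exI[of _ "\<beta> / (1 + Y t) - 3/2 * (\<beta> / Y t) + \<beta> / t"]) simp
  qed
  hence "0 \<le> h x" by (simp add: h_def Y_def)
  hence "- \<beta> * ln x \<le> ln ((1 + Y x) / 2) - 3/2 * ln (Y x)" by (simp add: h_def)
  hence "exp (- \<beta> * ln x) \<le> exp (ln ((1 + Y x) / 2) + (-3/2) * ln (Y x))" by simp
  also have "\<dots> = (1 + Y x) / 2 * Y x powr (-3/2)"
    using Y1[OF x] by (simp only: exp_add) (simp add: powr_def)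
  also have "\<dots> = (Y x powr (-1/2) + Y x powr (-3/2)) / 2"
  proof -
    have "Y x powr (-1/2) = Y x powr 1 * Y x powr (-3/2)"
      by (simp only: powr_add[symmetric]) simp
    thus ?thesis using Y1[OF x] by (simp add: algebra_simps)
  qed
  finally show ?thesis using x by (simp add: powr_def shock_shape'_def Y_def)
qed

lemma rarefaction_shape_le_wave_shape:
  assumes "4/5 \<le> \<beta>" "\<beta> < 1"
  shows "rarefaction_shape \<beta> x \<le> wave_shape \<beta> x"
proof (cases "x \<ge> 1")
  case True
  have "(\<lambda>x. shock_shape \<beta> x - rarefaction_shape \<beta> x) 1 \<le> (\<lambda>x. shock_shape \<beta> x - rarefaction_shape \<beta> x) x"
  proof (rule DERIV_nonneg_imp_nondecreasing[OF True])
    fix t :: real assume t: "1 \<le> t"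
    have "((\<lambda>x. shock_shape \<beta> x - rarefaction_shape \<beta> x) has_real_derivative
        shock_shape' \<beta> t - t powr (- \<beta>)) (at t)"
      using assms t by (intro DERIV_diff shock_shape_deriv rarefaction_shape_deriv) auto
    thus "\<exists>d. ((\<lambda>x. shock_shape \<beta> x - rarefaction_shape \<beta> x) has_real_derivative d) (at t) \<and> 0 \<le> d"
      using rarefaction_slope_le_shock_slope[OF assms t] by fastforce
  qed
  thus ?thesis using True by (simp add: wave_shape_def shock_shape_def rarefaction_shape_def)
qed (simp add: wave_shape_def)

section \<open>The wave curves of a state\<close>

definition slope_exponent :: "real \<Rightarrow> real" where
  "slope_exponent \<gamma> = (\<gamma> + 1) / (2 * \<gamma>)"

text \<open>
  The unit of velocity for which the slope of the wave curve at the pressure of the state becomes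
  \<open>1\<close>.
\<close>
definition velocity_scale :: "real \<Rightarrow> real \<Rightarrow> state \<Rightarrow> real" where
  "velocity_scale \<gamma> b Z = sound_speed \<gamma> b Z * (1 - b * rho Z) / \<gamma>"

lemma slope_exponent_bounds:
  assumes "1 < \<gamma>"
  shows "0 < slope_exponent \<gamma>" "slope_exponent \<gamma> < 1" "\<gamma> \<le> 5/3 \<Longrightarrow> 4/5 \<le> slope_exponent \<gamma>"
  using assms by (simp_all add: slope_exponent_def field_simps)

lemma sound_speed_pos: "1 < \<gamma> \<Longrightarrow> admissible b Z \<Longrightarrow> sound_speed \<gamma> b Z > 0"
  by (simp add: sound_speed_def admissible_def)

lemma velocity_scale_pos: "1 < \<gamma> \<Longrightarrow> admissible b Z \<Longrightarrow> velocity_scale \<gamma> b Z > 0"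
  using sound_speed_pos[of \<gamma> b Z] by (simp add: velocity_scale_def admissible_def)

lemma rarefaction_curve_eq:
  assumes "1 < \<gamma>"
  shows "rarefaction_curve \<gamma> b Z p
    = velocity_scale \<gamma> b Z * rarefaction_shape (slope_exponent \<gamma>) (p / pres Z)"
proof -
  have "1 - slope_exponent \<gamma> = (\<gamma> - 1) / (2 * \<gamma>)"
    using assms by (simp add: slope_exponent_def field_simps)
  thus ?thesis using assms
    by (simp add: rarefaction_curve_def velocity_scale_def rarefaction_shape_def)
qed

text \<open>
  With \<open>q\<close> the pressure of the state and \<open>Y = 1 + \<beta> * (p / q - 1)\<close>, one has
  \<open>(\<gamma> + 1) * (p + B) = 2 * \<gamma> * q * Y\<close>; this turns the square root of the shock curve into a multiple
  of \<open>1 / sqrt Y\<close>.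
\<close>
lemma shock_curve_eq:
  assumes "1 < \<gamma>" "admissible b Z" "p \<ge> pres Z"
  shows "shock_curve \<gamma> b Z p
    = velocity_scale \<gamma> b Z * shock_shape (slope_exponent \<gamma>) (p / pres Z)"
proof -
  define q r w where "q = pres Z" and "r = rho Z" and "w = 1 - b * rho Z"
  have pos: "q > 0" "r > 0" "w > 0" "p > 0"
    using assms by (auto simp: q_def r_def w_def admissible_def)
  define Y where "Y = 1 + slope_exponent \<gamma> * (p / q - 1)"
  have Y: "(\<gamma> + 1) * (p + coeff_B \<gamma> Z) = 2 * \<gamma> * q * Y"
    using assms pos by (simp add: Y_def coeff_B_def slope_exponent_def q_def[symmetric] field_simps)
  have "Y \<ge> 1"
    using assms pos slope_exponent_bounds[of \<gamma>] by (simp add: Y_def q_def)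
  have "(sound_speed \<gamma> b Z)\<^sup>2 = \<gamma> * q / (r * w)"
    using assms pos by (simp add: sound_speed_def q_def r_def w_def)
  hence scale: "(velocity_scale \<gamma> b Z / q)\<^sup>2 = w / (\<gamma> * r * q)"
    using assms pos unfolding velocity_scale_def w_def[symmetric]
    by (simp add: power_divide power_mult_distrib) (simp add: power2_eq_square field_simps)
  have "coeff_A \<gamma> b Z / (p + coeff_B \<gamma> Z) = 2 * w / (r * ((\<gamma> + 1) * (p + coeff_B \<gamma> Z)))"
    by (simp add: coeff_A_def w_def r_def mult_ac)
  also have "\<dots> = (velocity_scale \<gamma> b Z / q)\<^sup>2 / Y"
    using assms pos \<open>Y \<ge> 1\<close> unfolding Y scale by (simp add: field_simps)
  finally have "sqrt (coeff_A \<gamma> b Z / (p + coeff_B \<gamma> Z)) = velocity_scale \<gamma> b Z / q / sqrt Y"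
    using velocity_scale_pos[of \<gamma> b Z] assms pos by (simp add: real_sqrt_divide)
  hence "shock_curve \<gamma> b Z p = q * (p / q - 1) * (velocity_scale \<gamma> b Z / q / sqrt Y)"
    using pos by (simp add: shock_curve_def q_def[symmetric] right_diff_distrib)
  thus ?thesis using pos by (simp add: shock_shape_def Y_def q_def[symmetric])
qed

lemma wave_f_eq:
  assumes "1 < \<gamma>" "admissible b Z"
  shows "wave_f \<gamma> b Z p = velocity_scale \<gamma> b Z * wave_shape (slope_exponent \<gamma>) (p / pres Z)"
  using assms shock_curve_eq[of \<gamma> b Z p] rarefaction_curve_eq[of \<gamma> b Z p]
  by (simp add: wave_f_def wave_shape_def admissible_def)

lemma rarefaction_curve_le_wave_f:
  assumes "1 < \<gamma>" "\<gamma> \<le> 5/3" "admissible b Z"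
  shows "rarefaction_curve \<gamma> b Z p \<le> wave_f \<gamma> b Z p"
  using rarefaction_shape_le_wave_shape[of "slope_exponent \<gamma>" "p / pres Z"]
    slope_exponent_bounds[of \<gamma>] velocity_scale_pos[of \<gamma> b Z] assms
  by (simp add: wave_f_eq rarefaction_curve_eq)

definition wave_f' :: "real \<Rightarrow> real \<Rightarrow> state \<Rightarrow> real \<Rightarrow> real" where
  "wave_f' \<gamma> b Z p =
     velocity_scale \<gamma> b Z * (wave_shape' (slope_exponent \<gamma>) (p / pres Z) / pres Z)"

definition wave_f'' :: "real \<Rightarrow> real \<Rightarrow> state \<Rightarrow> real \<Rightarrow> real" where
  "wave_f'' \<gamma> b Z p =
     velocity_scale \<gamma> b Z * (wave_shape'' (slope_exponent \<gamma>) (p / pres Z) / pres Z / pres Z)"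

lemma wave_f_deriv:
  assumes "1 < \<gamma>" "admissible b Z" "p > 0"
  shows "(wave_f \<gamma> b Z has_real_derivative wave_f' \<gamma> b Z p) (at p)"
    and "(wave_f' \<gamma> b Z has_real_derivative wave_f'' \<gamma> b Z p) (at p)"
proof -
  have q: "pres Z > 0" using assms by (simp add: admissible_def)
  have chain: "((\<lambda>p. h (p / pres Z)) has_real_derivative d / pres Z) (at p)"
    if "(h has_real_derivative d) (at (p / pres Z))" for h d
    using DERIV_chain2[OF that DERIV_cdivide[OF DERIV_ident]] by simp
  show "(wave_f \<gamma> b Z has_real_derivative wave_f' \<gamma> b Z p) (at p)"
    unfolding ext[OF wave_f_eq[OF assms(1,2)]] wave_f'_def
    using q assms by (intro DERIV_cmult chain wave_shape_deriv slope_exponent_bounds) simp_all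
  show "(wave_f' \<gamma> b Z has_real_derivative wave_f'' \<gamma> b Z p) (at p)"
    using DERIV_cmult[OF DERIV_cdivide[OF chain[OF wave_shape'_deriv]]]
      slope_exponent_bounds[of \<gamma>] q assms
    by (simp add: wave_f'_def[abs_def] wave_f''_def)
qed

lemma wave_f'_pos:
  assumes "1 < \<gamma>" "admissible b Z" "p > 0" shows "wave_f' \<gamma> b Z p > 0"
  using velocity_scale_pos[of \<gamma> b Z] wave_shape'_pos[of "slope_exponent \<gamma>" "p / pres Z"]
    slope_exponent_bounds[of \<gamma>] assms by (simp add: wave_f'_def admissible_def)

lemma wave_f''_nonpos:
  assumes "1 < \<gamma>" "admissible b Z" "p > 0" shows "wave_f'' \<gamma> b Z p \<le> 0"
  using velocity_scale_pos[of \<gamma> b Z] wave_shape''_nonpos[of "slope_exponent \<gamma>" "p / pres Z"]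
    slope_exponent_bounds[of \<gamma>] assms
  by (simp add: wave_f''_def admissible_def mult_nonneg_nonpos divide_nonpos_pos)

lemma wave_f''_mono:
  assumes "1 < \<gamma>" "admissible b Z" "0 < p" "p \<le> q"
  shows "wave_f'' \<gamma> b Z p \<le> wave_f'' \<gamma> b Z q"
  unfolding wave_f''_def
  using assms velocity_scale_pos[of \<gamma> b Z] slope_exponent_bounds[of \<gamma>]
  by (intro mult_left_mono divide_right_mono wave_shape''_mono) (auto simp: admissible_def)

lemma bracketed_root_phi:
  assumes "1 < \<gamma>" "admissible b L" "admissible b R" "s > 0" "phi \<gamma> b L R s = 0"
  shows "bracketed_root (phi \<gamma> b L R) (\<lambda>p. wave_f' \<gamma> b L p + wave_f' \<gamma> b R p) s"
proof
  define d1 d2 where "d1 = (\<lambda>p. wave_f' \<gamma> b L p + wave_f' \<gamma> b R p)"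
    and "d2 = (\<lambda>p. wave_f'' \<gamma> b L p + wave_f'' \<gamma> b R p)"
  have d: "(d1 has_real_derivative d2 x) (at x)" if "x > 0" for x
    unfolding d1_def d2_def using assms that by (intro DERIV_add wave_f_deriv)
  have "convex_on {0<..} d1"
  proof (rule convex_on_realI)
    show "d2 x \<le> d2 y" if "x \<in> {0<..}" "y \<in> {0<..}" "x \<le> y" for x y
      unfolding d2_def using assms that by (intro add_mono wave_f''_mono) auto
  qed (use d in auto)
  thus "convex_on {0<..} (\<lambda>p. wave_f' \<gamma> b L p + wave_f' \<gamma> b R p)" by (simp add: d1_def)
  show "wave_f' \<gamma> b L y + wave_f' \<gamma> b R y \<le> wave_f' \<gamma> b L x + wave_f' \<gamma> b R x"
    if "0 < x" "x \<le> y" for x y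
  proof -
    have "d1 y \<le> d1 x"
    proof (rule DERIV_nonpos_imp_nonincreasing[OF that(2)])
      fix t assume "x \<le> t"
      hence "d2 t \<le> 0" unfolding d2_def using assms that by (intro add_nonpos_nonpos wave_f''_nonpos) auto
      thus "\<exists>y. (d1 has_real_derivative y) (at t) \<and> y \<le> 0" using d[of t] that \<open>x \<le> t\<close> by auto
    qed
    thus ?thesis by (simp add: d1_def)
  qed
  show "(phi \<gamma> b L R has_real_derivative wave_f' \<gamma> b L x + wave_f' \<gamma> b R x) (at x)" if "x > 0" for x
    unfolding phi_def[abs_def] using assms that
    by (auto intro!: derivative_eq_intros wave_f_deriv)
  show "wave_f' \<gamma> b L x + wave_f' \<gamma> b R x > 0" if "x > 0" for x
    using assms that by (intro add_pos_pos wave_f'_pos)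
qed (use assms in auto)

lemma rarefaction_curve_strict_mono:
  assumes "1 < \<gamma>" "admissible b Z" "0 \<le> p" "p < q"
  shows "rarefaction_curve \<gamma> b Z p < rarefaction_curve \<gamma> b Z q"
proof -
  have "(p / pres Z) powr ((\<gamma> - 1) / (2 * \<gamma>)) < (q / pres Z) powr ((\<gamma> - 1) / (2 * \<gamma>))"
    using assms by (intro powr_less_mono2) (auto simp: admissible_def divide_strict_right_mono)
  thus ?thesis
    unfolding rarefaction_curve_def using assms sound_speed_pos[of \<gamma> b Z]
    by (intro mult_strict_left_mono) (auto simp: admissible_def)
qed

lemma rarefaction_curve_unbounded:
  assumes "1 < \<gamma>" "admissible b Z" "K \<ge> 0"
  obtains p where "p \<ge> pres Z" "rarefaction_curve \<gamma> b Z p = K"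
proof -
  define \<alpha> C where "\<alpha> = (\<gamma> - 1) / (2 * \<gamma>)"
    and "C = 2 * sound_speed \<gamma> b Z * (1 - b * rho Z) / (\<gamma> - 1)"
  have pos: "\<alpha> > 0" "C > 0" "pres Z > 0"
    using assms sound_speed_pos[of \<gamma> b Z] by (auto simp: \<alpha>_def C_def admissible_def)
  define x where "x = (1 + K / C) powr (1 / \<alpha>)"
  have "x \<ge> 1" using pos assms by (simp add: x_def ge_one_powr_ge_zero)
  moreover have "x powr \<alpha> = 1 + K / C"
    using pos assms by (simp add: x_def powr_powr add_pos_nonneg)
  hence "rarefaction_curve \<gamma> b Z (pres Z * x) = K"
    using pos by (simp add: rarefaction_curve_def \<alpha>_def[symmetric] C_def[symmetric])
  ultimately show thesis using that[of "pres Z * x"] pos by simp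
qed

lemma rarefaction_curve_nonneg:
  assumes "1 < \<gamma>" "admissible b Z" "p \<ge> pres Z"
  shows "rarefaction_curve \<gamma> b Z p \<ge> 0"
  using rarefaction_curve_strict_mono[of \<gamma> b Z "pres Z" p] assms
  by (cases "p = pres Z") (auto simp: rarefaction_curve_def admissible_def)

text \<open>
  \<^const>\<open>phi_R\<close> increases strictly and is unbounded, so its zero exists, is unique, and lies to
  the right of every pressure at which \<^const>\<open>phi_R\<close> is negative.
\<close>
lemma p_tilde_star_properties:
  assumes "1 < \<gamma>" "admissible b L" "admissible b R" "p\<^sub>0 > 0" "phi_R \<gamma> b L R p\<^sub>0 < 0"
  shows "p_tilde_star \<gamma> b L R > p\<^sub>0" "phi_R \<gamma> b L R (p_tilde_star \<gamma> b L R) = 0"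
proof -
  have mono: "phi_R \<gamma> b L R p < phi_R \<gamma> b L R q" if "0 \<le> p" "p < q" for p q
    using rarefaction_curve_strict_mono[OF assms(1,2) that]
      rarefaction_curve_strict_mono[OF assms(1,3) that] by (simp add: phi_R_def)
  obtain p1 where p1: "p1 \<ge> pres L" "rarefaction_curve \<gamma> b L p1 = \<bar>vel R - vel L\<bar>"
    by (rule rarefaction_curve_unbounded[OF assms(1,2) abs_ge_zero])
  define P where "P = max p1 (pres R)"
  have "0 \<le> p1" "p1 \<le> P" using p1 assms by (auto simp: P_def admissible_def)
  hence "rarefaction_curve \<gamma> b L p1 \<le> rarefaction_curve \<gamma> b L P"
    using rarefaction_curve_strict_mono[OF assms(1,2), of p1 P] by (cases "p1 = P") auto
  moreover have "0 \<le> rarefaction_curve \<gamma> b R P"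
    using assms by (intro rarefaction_curve_nonneg) (auto simp: P_def)
  ultimately have P: "phi_R \<gamma> b L R P \<ge> 0" using p1 by (simp add: phi_R_def)
  have "P \<ge> 0" using p1 assms by (auto simp: P_def admissible_def)
  hence "p\<^sub>0 \<le> P" using mono[of P p\<^sub>0] P assms by linarith
  moreover have "continuous_on {p\<^sub>0..P} (phi_R \<gamma> b L R)"
    unfolding phi_R_def[abs_def] rarefaction_curve_def using assms
    by (intro continuous_intros) (auto simp: admissible_def)
  ultimately obtain p where p: "p\<^sub>0 \<le> p" "phi_R \<gamma> b L R p = 0"
    using IVT'[of "phi_R \<gamma> b L R" p\<^sub>0 0 P] P assms by auto
  have "p_tilde_star \<gamma> b L R = p"
    unfolding p_tilde_star_def
  proof (rule the_equality)
    show "q = p" if "q \<ge> 0 \<and> phi_R \<gamma> b L R q = 0" for q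
      using mono[of p q] mono[of q p] p that assms by linarith
  qed (use p assms in auto)
  moreover have "p \<noteq> p\<^sub>0" using p assms by auto
  ultimately show "p_tilde_star \<gamma> b L R > p\<^sub>0" "phi_R \<gamma> b L R (p_tilde_star \<gamma> b L R) = 0"
    using p by auto
qed

section \<open>The maximum wave speed as a function of the intermediate pressure\<close>

definition extreme_speed :: "real \<Rightarrow> real \<Rightarrow> state \<Rightarrow> state \<Rightarrow> real \<Rightarrow> real" where
  "extreme_speed \<gamma> b L R p = max (neg_part (speed_1 \<gamma> b L p)) (pos_part (speed_3 \<gamma> b R p))"

lemma lambda_eq_extreme_speed:
  "lambda_max \<gamma> b L R = extreme_speed \<gamma> b L R (p_star \<gamma> b L R)"
  "lambda_lower \<gamma> b L R (p1, p2) = extreme_speed \<gamma> b L R p1"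
  "lambda_upper \<gamma> b L R (p1, p2) = extreme_speed \<gamma> b L R p2"
  by (simp_all add: lambda_max_def lambda_lower_def lambda_upper_def extreme_speed_def
      pos_part_def neg_part_def max.commute)

lemma extreme_speed_mono:
  assumes "1 < \<gamma>" "admissible b L" "admissible b R" "p \<le> q"
  shows "extreme_speed \<gamma> b L R p \<le> extreme_speed \<gamma> b L R q"
proof -
  have "sound_speed \<gamma> b Z * speed_factor \<gamma> Z p \<le> sound_speed \<gamma> b Z * speed_factor \<gamma> Z q"
    if "admissible b Z" for Z
  proof -
    have "(p - pres Z) / pres Z \<le> (q - pres Z) / pres Z"
      using that assms by (intro divide_right_mono) (auto simp: admissible_def)
    hence "pos_part ((p - pres Z) / pres Z) \<le> pos_part ((q - pres Z) / pres Z)"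
      by (auto simp: pos_part_def)
    thus ?thesis using assms sound_speed_pos[OF assms(1) that] unfolding speed_factor_def
      by (intro mult_left_mono real_sqrt_le_mono add_left_mono) auto
  qed
  from this[OF assms(2)] this[OF assms(3)] show ?thesis
    by (auto simp: extreme_speed_def speed_1_def speed_3_def neg_part_def pos_part_def)
qed

lemma tendsto_extreme_speed:
  assumes "x \<longlonglongrightarrow> s" "admissible b L" "admissible b R"
  shows "(\<lambda>k. extreme_speed \<gamma> b L R (x k)) \<longlonglongrightarrow> extreme_speed \<gamma> b L R s"
  unfolding extreme_speed_def speed_1_def speed_3_def speed_factor_def pos_part_def neg_part_def
  by (intro tendsto_intros assms) (use assms in \<open>auto simp: admissible_def\<close>)

text \<open>
  This says that the extreme waves move faster than the fluid between them. On the shock branch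
  the quotient of the two sides is \<open>(1 - b * \<rho>) * (x - 1) / (\<gamma> * Y)\<close> with \<open>x = p / p\<^sub>Z\<close> and
  \<open>Y = 1 + \<beta> * (x - 1)\<close>; it is below \<open>1\<close> because \<open>b \<ge> 0\<close> and \<open>\<gamma> * \<beta> = (\<gamma> + 1) / 2 > 1\<close>. On the
  rarefaction branch the left side is not positive.
\<close>
lemma wave_f_less_acoustic_speed:
  assumes "1 < \<gamma>" "b \<ge> 0" "admissible b Z" "p > 0"
  shows "wave_f \<gamma> b Z p < sound_speed \<gamma> b Z * speed_factor \<gamma> Z p"
proof (cases "p \<ge> pres Z")
  case True
  define x where "x = p / pres Z"
  define Y where "Y = 1 + slope_exponent \<gamma> * (x - 1)"
  have q: "pres Z > 0" using assms by (simp add: admissible_def)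
  have x: "x \<ge> 1" using True q by (simp add: x_def)
  have Y: "Y \<ge> 1" using x slope_exponent_bounds[OF assms(1)] by (simp add: Y_def)
  have factor: "speed_factor \<gamma> Z p = sqrt Y"
    using x q by (simp add: speed_factor_def Y_def slope_exponent_def pos_part_def x_def diff_divide_distrib)
  have "1 * (x - 1) \<le> (\<gamma> + 1) / 2 * (x - 1)"
    using assms x by (intro mult_right_mono) auto
  also have "\<dots> < \<gamma> + (\<gamma> + 1) / 2 * (x - 1)" using assms by simp
  also have "\<dots> = \<gamma> * Y" using assms by (simp add: Y_def slope_exponent_def field_simps)
  finally have less: "x - 1 < \<gamma> * Y" by simp
  have "(1 - b * rho Z) * (x - 1) \<le> 1 * (x - 1)"
    using assms x by (intro mult_right_mono) (auto simp: admissible_def)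
  hence "(1 - b * rho Z) * (x - 1) / (\<gamma> * sqrt Y) < \<gamma> * Y / (\<gamma> * sqrt Y)"
    using less Y assms by (intro divide_strict_right_mono) auto
  also have "\<gamma> * Y / (\<gamma> * sqrt Y) = sqrt Y" using assms Y by (simp add: real_div_sqrt)
  finally have "sound_speed \<gamma> b Z * ((1 - b * rho Z) * (x - 1) / (\<gamma> * sqrt Y))
      < sound_speed \<gamma> b Z * sqrt Y"
    using sound_speed_pos assms by (intro mult_strict_left_mono) auto
  thus ?thesis
    using assms x unfolding factor
    by (simp add: wave_f_eq wave_shape_def x_def[symmetric] shock_shape_def Y_def[symmetric]
        velocity_scale_def)
next
  case False
  have "wave_f \<gamma> b Z p \<le> 0"
  proof -
    have "rarefaction_shape (slope_exponent \<gamma>) (p / pres Z) \<le> 0"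
    proof -
      have "(p / pres Z) powr (1 - slope_exponent \<gamma>) \<le> 1"
        using False assms slope_exponent_bounds[OF assms(1)]
        by (intro powr_le1) (auto simp: admissible_def)
      thus ?thesis using slope_exponent_bounds[OF assms(1)]
        by (simp add: rarefaction_shape_def divide_nonpos_pos)
    qed
    thus ?thesis using False velocity_scale_pos[OF assms(1,3)] assms
      by (simp add: wave_f_eq wave_shape_def admissible_def mult_nonneg_nonpos)
  qed
  moreover have "speed_factor \<gamma> Z p > 0"
    using assms by (auto simp: speed_factor_def pos_part_def intro!: add_pos_nonneg)
  hence "0 < sound_speed \<gamma> b Z * speed_factor \<gamma> Z p" using sound_speed_pos assms by simp
  ultimately show ?thesis by linarith
qed

text \<open>
  At the intermediate pressure the left wave is strictly slower than the right one, so the two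
  speeds cannot be nonnegative and nonpositive respectively. Without this the relative tolerance
  would be unattainable.
\<close>
lemma extreme_speed_pos:
  assumes "1 < \<gamma>" "b \<ge> 0" "admissible b L" "admissible b R" "p > 0" "phi \<gamma> b L R p = 0"
  shows "extreme_speed \<gamma> b L R p > 0"
proof -
  have "speed_1 \<gamma> b L p < speed_3 \<gamma> b R p"
    using wave_f_less_acoustic_speed[OF assms(1-3,5)] wave_f_less_acoustic_speed[OF assms(1,2,4,5)]
      assms(6) by (simp add: phi_def speed_1_def speed_3_def)
  thus ?thesis by (auto simp: extreme_speed_def neg_part_def pos_part_def less_max_iff_disj)
qed

section \<open>Termination and error bound of the algorithms\<close>

definition brackets :: "real \<Rightarrow> real \<times> real \<Rightarrow> bool" where
  "brackets s q \<longleftrightarrow> 0 < fst q \<and> fst q \<le> s \<and> s \<le> snd q"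

locale riemann_problem =
  fixes \<gamma> b :: real and L R :: state
  assumes gamma: "1 < \<gamma>" "\<gamma> \<le> 5 / 3" and covolume: "b \<ge> 0"
    and admissible: "admissible b L" "admissible b R"
    and phi_p_min: "phi \<gamma> b L R (p_min L R) < 0"
begin

text \<open>
  The rarefaction curve lies below the wave curve, so \<^const>\<open>phi\<close> is nonnegative at
  \<^const>\<open>p_tilde_star\<close>. This yields at once the existence of \<^const>\<open>p_star\<close> and an upper bound
  for it.
\<close>
lemma bracketed_root_p_star:
    "bracketed_root (phi \<gamma> b L R) (\<lambda>p. wave_f' \<gamma> b L p + wave_f' \<gamma> b R p) (p_star \<gamma> b L R)"
  and p_star_le_p_tilde_star: "p_star \<gamma> b L R \<le> p_tilde_star \<gamma> b L R"
proof -
  define p\<^sub>0 P where "p\<^sub>0 = p_min L R" and "P = p_tilde_star \<gamma> b L R"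
  have le: "phi_R \<gamma> b L R p \<le> phi \<gamma> b L R p" for p
    using rarefaction_curve_le_wave_f[of \<gamma>] gamma admissible by (simp add: phi_R_def phi_def add_mono)
  have p0: "p\<^sub>0 > 0" using admissible by (simp add: p\<^sub>0_def p_min_def admissible_def)
  have neg: "phi \<gamma> b L R p\<^sub>0 < 0" using phi_p_min by (simp add: p\<^sub>0_def)
  hence "phi_R \<gamma> b L R p\<^sub>0 < 0" using le[of p\<^sub>0] by simp
  from p_tilde_star_properties[OF gamma(1) admissible p0 this]
  have P: "p\<^sub>0 < P" "phi \<gamma> b L R P \<ge> 0" using le[of P] by (auto simp: P_def)
  have "isCont (phi \<gamma> b L R) p" if "p > 0" for p
    unfolding phi_def[abs_def] using gamma admissible that
    by (intro continuous_intros DERIV_isCont[OF wave_f_deriv(1)])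
  hence "continuous_on {p\<^sub>0..P} (phi \<gamma> b L R)"
    using p0 by (intro continuous_at_imp_continuous_on) auto
  then obtain s where s: "p\<^sub>0 \<le> s" "phi \<gamma> b L R s = 0"
    using IVT'[of "phi \<gamma> b L R" p\<^sub>0 0 P] neg P by auto
  hence "s > 0" using p0 by simp
  interpret bracketed_root "phi \<gamma> b L R" "\<lambda>p. wave_f' \<gamma> b L p + wave_f' \<gamma> b R p" s
    using bracketed_root_phi gamma admissible \<open>s > 0\<close> s by blast
  have "p_star \<gamma> b L R = s" unfolding p_star_def
  proof (rule the_equality)
    show "q = s" if "q > 0 \<and> phi \<gamma> b L R q = 0" for q
      using nonpos_iff[of q] nonneg_iff[of q] that by auto
  qed (use s \<open>s > 0\<close> in auto)
  thus "bracketed_root (phi \<gamma> b L R) (\<lambda>p. wave_f' \<gamma> b L p + wave_f' \<gamma> b R p) (p_star \<gamma> b L R)"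
    using bracketed_root_axioms by simp
  show "p_star \<gamma> b L R \<le> p_tilde_star \<gamma> b L R"
    using nonneg_iff[of P] P p0 \<open>p_star \<gamma> b L R = s\<close> by (simp add: P_def)
qed

sublocale bracketed_root "phi \<gamma> b L R" "\<lambda>p. wave_f' \<gamma> b L p + wave_f' \<gamma> b R p" "p_star \<gamma> b L R"
  by (rule bracketed_root_p_star)

lemma brackets_initial_guess: "brackets (p_star \<gamma> b L R) (initial_guess \<gamma> b L R)"
proof -
  have "p_min L R > 0" "p_max L R > 0"
    using admissible by (auto simp: p_min_def p_max_def admissible_def)
  thus ?thesis
    using nonpos_iff[of "p_min L R"] nonpos_iff[of "p_max L R"] nonneg_iff[of "p_max L R"]
      p_star_le_p_tilde_star phi_p_min
    by (auto simp: brackets_def initial_guess_def)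
qed

lemma brackets_newton_update:
  "brackets (p_star \<gamma> b L R) q \<Longrightarrow> brackets (p_star \<gamma> b L R) (newton_update \<gamma> b L R q)"
  using newton_le_root[of "snd q"]
  by (auto simp: brackets_def newton_update_def deriv_eq split: prod.splits)

lemma lambda_max_pos: "lambda_max \<gamma> b L R > 0"
  unfolding lambda_eq_extreme_speed
  by (rule extreme_speed_pos[OF gamma(1) covolume admissible root_pos root])

text \<open>
  The exact value lies between the lower and the upper speed, so the gap between the computable
  speeds controls the error.
\<close>
lemma tolerance_met_imp_error_le:
  assumes "\<epsilon> > 0" "brackets (p_star \<gamma> b L R) q" "tolerance_met \<gamma> b L R \<epsilon> q"
  shows "\<bar>lambda_upper \<gamma> b L R q - lambda_max \<gamma> b L R\<bar> \<le> \<epsilon> * lambda_max \<gamma> b L R"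
proof -
  obtain p1 p2 where q: "q = (p1, p2)" by force
  define l m u where "l = lambda_lower \<gamma> b L R q" and "m = lambda_max \<gamma> b L R"
    and "u = lambda_upper \<gamma> b L R q"
  have "l \<le> m" "m \<le> u"
    using assms extreme_speed_mono[OF gamma(1) admissible]
    by (auto simp: l_def m_def u_def q lambda_eq_extreme_speed brackets_def)
  have "l > 0" "u / l - 1 \<le> \<epsilon>" using assms(3) by (auto simp: tolerance_met_def l_def u_def)
  hence "u - l \<le> \<epsilon> * l" by (simp add: field_simps)
  also have "\<dots> \<le> \<epsilon> * m" using \<open>l \<le> m\<close> assms(1) by simp
  finally show ?thesis using \<open>l \<le> m\<close> \<open>m \<le> u\<close> by (simp add: m_def u_def)
qed

text \<open>
  A bracket collapsed to one point has hit the root exactly. The divided differences of the next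
  step would divide by zero there, but the algorithm has already stopped.
\<close>
lemma collapsed_bracket_meets_tolerance:
  assumes "\<epsilon> > 0" "brackets (p_star \<gamma> b L R) (p, p)"
  shows "tolerance_met \<gamma> b L R \<epsilon> (p, p)"
proof -
  have "p = p_star \<gamma> b L R" using assms by (simp add: brackets_def)
  thus ?thesis using lambda_max_pos assms by (simp add: tolerance_met_def lambda_eq_extreme_speed)
qed

lemma alg2_iterate_brackets:
  assumes "\<epsilon> > 0" "brackets (p_star \<gamma> b L R) q"
    and "\<And>j. j < k \<Longrightarrow> \<not> tolerance_met \<gamma> b L R \<epsilon> (alg2_iterate \<gamma> b L R q j)"
  shows "brackets (p_star \<gamma> b L R) (alg2_iterate \<gamma> b L R q k)"
  using assms(3)
proof (induction k)
  case 0
  then show ?case using assms(2) by simp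
next
  case (Suc k)
  obtain p1 p2 where k: "alg2_iterate \<gamma> b L R q k = (p1, p2)" by force
  have prev: "brackets (p_star \<gamma> b L R) (p1, p2)" using Suc k by simp
  moreover have "p1 \<noteq> p2"
    using collapsed_bracket_meets_tolerance[OF assms(1), of p1] prev Suc.prems[of k] k by auto
  ultimately have "0 < p1" "p1 \<le> p_star \<gamma> b L R" "p_star \<gamma> b L R \<le> p2" "p1 < p2"
    by (auto simp: brackets_def)
  with step_bounds[OF this] show ?case by (auto simp: brackets_def k)
qed

text \<open>
  If the tolerance were never met, the iteration would go on forever and both ends of the bracket
  would converge to the root. The lower and upper speeds would then converge to the same positive
  limit, so their quotient would tend to \<open>1\<close>.
\<close>
lemma tolerance_met_eventually:
  assumes "\<epsilon> > 0" "brackets (p_star \<gamma> b L R) q"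
  shows "\<exists>k. tolerance_met \<gamma> b L R \<epsilon> (alg2_iterate \<gamma> b L R q k)"
proof (rule ccontr)
  define s where "s = p_star \<gamma> b L R"
  define x y where "x = (\<lambda>k. fst (alg2_iterate \<gamma> b L R q k))"
    and "y = (\<lambda>k. snd (alg2_iterate \<gamma> b L R q k))"
  have iter: "alg2_iterate \<gamma> b L R q k = (x k, y k)" for k by (simp add: x_def y_def)
  have limit: "extreme_speed \<gamma> b L R s > 0"
    using lambda_max_pos by (simp add: lambda_eq_extreme_speed s_def)
  assume "\<not> ?thesis"
  hence never: "\<not> tolerance_met \<gamma> b L R \<epsilon> (x k, y k)" for k
    using iter by simp
  hence br: "brackets s (x k, y k)" for k
    using alg2_iterate_brackets[OF assms, of k] by (simp add: iter s_def)
  have "x k \<noteq> y k" for k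
    using collapsed_bracket_meets_tolerance[OF assms(1), of "x k"] br[of k] never[of k]
    by (auto simp: s_def)
  moreover have "x (Suc k) = p_d (phi \<gamma> b L R) (x k) (y k)"
    "y (Suc k) = p_u (phi \<gamma> b L R) (x k) (y k)" for k
    by (simp_all add: x_def y_def split: prod.split)
  ultimately have lim: "x \<longlonglongrightarrow> s" "y \<longlonglongrightarrow> s"
    using iterates_tendsto_root[of x y] br[of 0] by (auto simp: brackets_def s_def)
  have l: "(\<lambda>k. extreme_speed \<gamma> b L R (x k)) \<longlonglongrightarrow> extreme_speed \<gamma> b L R s"
    and u: "(\<lambda>k. extreme_speed \<gamma> b L R (y k)) \<longlonglongrightarrow> extreme_speed \<gamma> b L R s"
    using tendsto_extreme_speed lim admissible by blast+
  have "(\<lambda>k. extreme_speed \<gamma> b L R (y k) / extreme_speed \<gamma> b L R (x k) - 1)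
      \<longlonglongrightarrow> extreme_speed \<gamma> b L R s / extreme_speed \<gamma> b L R s - 1"
    using limit by (intro tendsto_intros l u) simp
  hence "(\<lambda>k. extreme_speed \<gamma> b L R (y k) / extreme_speed \<gamma> b L R (x k) - 1) \<longlonglongrightarrow> 0"
    using limit by simp
  hence "eventually (\<lambda>k. extreme_speed \<gamma> b L R (y k) / extreme_speed \<gamma> b L R (x k) - 1 < \<epsilon>) sequentially"
    using assms(1) by (rule order_tendstoD)
  moreover have "eventually (\<lambda>k. extreme_speed \<gamma> b L R (x k) > 0) sequentially"
    using l limit by (rule order_tendstoD)
  ultimately have "eventually (\<lambda>k. tolerance_met \<gamma> b L R \<epsilon> (x k, y k)) sequentially"
    by eventually_elim (simp add: tolerance_met_def lambda_eq_extreme_speed)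
  thus False using never by simp
qed

text \<open>
  Up to the first stopping index the pairs are brackets, for which the safeguard is silent; so
  the algorithm can only have stopped because the tolerance was met.
\<close>
lemma alg2_correct:
  assumes "\<epsilon> > 0" "brackets (p_star \<gamma> b L R) q"
  shows "\<exists>k. alg2_terminates_at \<gamma> b L R \<epsilon> q k \<and>
    \<bar>lambda_upper \<gamma> b L R (alg2_iterate \<gamma> b L R q k) - lambda_max \<gamma> b L R\<bar>
      \<le> \<epsilon> * lambda_max \<gamma> b L R"
proof -
  define k where "k = (LEAST k. alg2_stops \<gamma> b L R \<epsilon> (alg2_iterate \<gamma> b L R q k))"
  have "\<exists>k. alg2_stops \<gamma> b L R \<epsilon> (alg2_iterate \<gamma> b L R q k)"
    using tolerance_met_eventually[OF assms] by (auto simp: alg2_stops_def)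
  hence stops: "alg2_stops \<gamma> b L R \<epsilon> (alg2_iterate \<gamma> b L R q k)"
    unfolding k_def by (rule LeastI_ex)
  have before: "\<not> alg2_stops \<gamma> b L R \<epsilon> (alg2_iterate \<gamma> b L R q j)" if "j < k" for j
    using not_less_Least that unfolding k_def by blast
  hence br: "brackets (p_star \<gamma> b L R) (alg2_iterate \<gamma> b L R q k)"
    using alg2_iterate_brackets[OF assms] by (simp add: alg2_stops_def)
  obtain p1 p2 where k: "alg2_iterate \<gamma> b L R q k = (p1, p2)" by force
  have "\<not> safeguard \<gamma> b L R (alg2_iterate \<gamma> b L R q k)"
    using br nonpos_iff[of p1] nonneg_iff[of p2] by (auto simp: safeguard_def brackets_def k)
  hence "tolerance_met \<gamma> b L R \<epsilon> (alg2_iterate \<gamma> b L R q k)"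
    using stops by (simp add: alg2_stops_def)
  thus ?thesis
    using tolerance_met_imp_error_le[OF assms(1) br] stops before
    by (auto simp: alg2_terminates_at_def)
qed

end

theorem theorem4p6:
  fixes \<gamma> b \<epsilon> :: real and L R :: state
  assumes "1 < \<gamma>" and "\<gamma> \<le> 5 / 3" and "b \<ge> 0"
    and "admissible b L" and "admissible b R"
    and "phi \<gamma> b L R (p_min L R) < 0" and "phi \<gamma> b L R (p_max L R) \<noteq> 0"
    and "\<epsilon> > 0"
  shows "case algorithm1 \<gamma> b L R \<epsilon> of
      Stop l \<Rightarrow> \<bar>l - lambda_max \<gamma> b L R\<bar> \<le> \<epsilon> * lambda_max \<gamma> b L R
    | Pass q \<Rightarrow> \<exists>k. alg2_terminates_at \<gamma> b L R \<epsilon> q k \<and>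
        \<bar>lambda_upper \<gamma> b L R (alg2_iterate \<gamma> b L R q k) - lambda_max \<gamma> b L R\<bar>
          \<le> \<epsilon> * lambda_max \<gamma> b L R"
proof -
  interpret riemann_problem \<gamma> b L R by unfold_locales (use assms in auto)
  show ?thesis
    using tolerance_met_imp_error_le[OF assms(8) brackets_initial_guess]
      alg2_correct[OF assms(8) brackets_newton_update[OF brackets_initial_guess]]
    by (simp add: algorithm1_def Let_def)
qed

end
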